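(* In the setting of the context (standing assumptions (A1)–(A6) and admissibility of killed potentials), suppose that $\tau_{\mathcal D}$ is optimal, i.e. $V(x)=\mathbb E_x[e^{-r\tau_{\mathcal D}}G(X_{\tau_{\mathcal D}})-\int_0^{\tau_{\mathcal D}}e^{-rs}c(X_s)\,ds]$, and that the Itô–Tanaka identity $$e^{-rt}G(X_t)=G(x)+\int_0^te^{-rs}c(X_s)\,ds-\int_0^te^{-rs}\,dA^\Gamma_s+M_t,\qquad M\text{ a local martingale},$$ may be applied up to $\tau_{\mathcal D}$ with localisation and uniform integrability, that is: it holds on $[0,\tau_{\mathcal D}]$; there are stopping times $\sigma_k\uparrow\infty$ such that, with $\theta_k=k\wedge\sigma_k\wedge\tau_{\mathcal D}$, $\mathbb E_x[M_{\theta_k}]=0$; the random variables $e^{-r\theta_k}G(X_{\theta_k})-\int_0^{\theta_k}e^{-rs}c(X_s)\,ds$ are uniformly integrable; and they converge almost surely to $e^{-r\tau_{\mathcal D}}G(X_{\tau_{\mathcal D}})-\int_0^{\tau_{\mathcal D}}e^{-rs}c(X_s)\,ds$. Then $$V(x)=G(x)-R_r^{\mathcal C}\Gamma(x)=G(x)-\mathbb E_x\Big[\int_0^{\tau_{\mathcal D}}e^{-rs}\,dA^\Gamma_s\Big].$$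
   Context: Let $\mathbb R^2_+=[0,\infty)^2$, $W$ a two-dimensional Brownian motion on a filtered probability space satisfying the usual conditions. For $x\in\mathbb R^2_+$ the normally reflected diffusion solves $X_t=x+\int_0^t\mu(X_s)\,ds+\int_0^t\sigma(X_s)\,dW_s+L_t$ in $\mathbb R^2_+$, with $L=(L^1,L^2)$, each $L^i$ continuous, non-decreasing, $L^i_0=0$, $\int_0^\infty\mathbf 1_{\{X^i_t>0\}}dL^i_t=0$. Put $a=\sigma\sigma^\top$; $r>0$. Standing assumptions: (A1) $\mu,\sigma$ locally Lipschitz with at most linear growth. (A2) $a$ locally uniformly elliptic on $\mathbb R^2_+$ (on each compact $K$, $\xi^\top a\xi\ge\lambda_K|\xi|^2$ with $\lambda_K>0$). (A3) Unique strong solution for each $x$; $(X^x)_x$ strong Markov. (A4) For every $T>0$, compact $K$, some $q_0\ge1$: $\lim_{y\to x}\mathbb E[\sup_{t\le T}|X^y_t-X^x_t|^{q_0}]=0$ uniformly on $K$. (A5) $G(x_1,x_2)=x_1\vee\alpha x_2$, $\alpha>0$; $c:\mathbb R^2_+\to[0,\infty)$ continuous. (A6) $0\le V(x)\le C_V(1+|x|^p)$ for some $C_V,p$, and payoff terms are integrable for the stopping times considered. Value function: $V(x)=\sup_\tau\mathbb E_x[e^{-r\tau}G(X_\tau)-\int_0^\tau e^{-rs}c(X_s)\,ds]$ over stopping times $\tau\in[0,\infty]$, with $e^{-r\tau}G(X_\tau):=0$ on $\{\tau=\infty\}$. $\mathcal D=\{V=G\}$, $\mathcal C=\{V>G\}$,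 $\tau_{\mathcal D}=\inf\{t:X_t\in\mathcal D\}$. Stopping gain: $\Gamma=c+rG-\mathcal LG=\Gamma^{\mathrm{ac}}dx+\Gamma^\Delta$, where $\mathcal L=\sum_i\mu_i\partial_i+\frac12\sum_{ij}a_{ij}\partial_{ij}$, $\Gamma^{\mathrm{ac}}=c+rx_1-\mu_1$ on $\{x_1>\alpha x_2\}$, $\Gamma^{\mathrm{ac}}=c+r\alpha x_2-\alpha\mu_2$ on $\{x_1<\alpha x_2\}$, and $\Gamma^\Delta(dx)=-\frac{q(x)}{2\sqrt{1+\alpha^2}}\sigma_\Delta(dx)$ with $q=a_{11}-2\alpha a_{12}+\alpha^2a_{22}$ and $\sigma_\Delta$ arc-length on $\Delta=\{x_1=\alpha x_2\}$. $A^\Gamma$ is the associated signed continuous additive functional, $A^\Gamma_t=\int_0^t\Gamma^{\mathrm{ac}}(X_s)\,ds-\frac12L^0_t(Y)$, where $Y=X^1-\alpha X^2$ and $L^0(Y)$ is its local time at $0$ (normalised by Tanaka's formula $d|Y|=\operatorname{sgn}(Y)dY+dL^0(Y)$). Killed resolvent: for a signed measure $\nu$ with additive functional $A^\nu$, $R_r^{\mathcal C}\nu(x)=\mathbb E_x[\int_0^{\tau_{\mathcal D}}e^{-rs}\,dA^\nu_s]$. Admissibility: $\Gamma^\pm$ (positive and negative parts) are smooth measures with $R_r^{\mathcal C}\Gamma^+(x)+R_r^{\mathcal C}\Gamma^-(x)<\infty$. *)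

theory Defs
  imports "HOL-Probability.Probability"
begin

(* Processes are indexed by real times t >= 0 (values at negative times are irrelevant);
   filtrations and stopping times use [0,\<infinity>] = ennreal, so that the library's
   stopping_time and pre_sigma apply to stopping times with values in [0,\<infinity>]. *)

definition quadrant :: "(real^2) set" where
  "quadrant = {x. 0 \<le> x $ 1 \<and> 0 \<le> x $ 2}"

record 'w model =
  Prob :: "'w measure"
  Filt :: "ennreal \<Rightarrow> 'w measure"
  Bm :: "real \<Rightarrow> 'w \<Rightarrow> real^2"
  drift :: "real^2 \<Rightarrow> real^2"                         (* mu *)
  disp :: "real^2 \<Rightarrow> real^2^2"                        (* sigma *)
  flow :: "real^2 \<Rightarrow> real \<Rightarrow> 'w \<Rightarrow> real^2"              (* X^x *)
  push :: "real^2 \<Rightarrow> real \<Rightarrow> 'w \<Rightarrow> real^2"              (* L = (L^1, L^2), started from x *)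
  loctime :: "real^2 \<Rightarrow> real \<Rightarrow> 'w \<Rightarrow> real"             (* L^0(Y), started from x *)
  cost :: "real^2 \<Rightarrow> real"                            (* c *)
  slope :: real                                       (* alpha *)
  rate :: real                                        (* r *)

definition diffusion_matrix :: "'w model \<Rightarrow> real^2 \<Rightarrow> real^2^2" where
  "diffusion_matrix S x = disp S x ** transpose (disp S x)"


subsection \<open>Filtered probability space, Brownian motion, local martingales\<close>

definition adapted :: "'w model \<Rightarrow> (real \<Rightarrow> 'w \<Rightarrow> 'b::topological_space) \<Rightarrow> bool" where
  "adapted S Z \<longleftrightarrow> (\<forall>t\<ge>0. Z t \<in> borel_measurable (Filt S (ennreal t)))"

definition continuous_paths :: "'w model \<Rightarrow> (real \<Rightarrow> 'w \<Rightarrow> 'b::topological_space) \<Rightarrow> bool" where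
  "continuous_paths S Z \<longleftrightarrow> (\<forall>\<omega>\<in>space (Prob S). continuous_on {0..} (\<lambda>t. Z t \<omega>))"

definition progressive :: "'w model \<Rightarrow> (real \<Rightarrow> 'w \<Rightarrow> real) \<Rightarrow> bool" where
  "progressive S H \<longleftrightarrow> (\<forall>t\<ge>0. (\<lambda>(s, \<omega>). H s \<omega>)
     \<in> borel_measurable (restrict_space borel {0..t} \<Otimes>\<^sub>M Filt S (ennreal t)))"

definition usual_conditions :: "'w model \<Rightarrow> bool" where
  "usual_conditions S \<longleftrightarrow>
     prob_space (Prob S) \<and>
     filtration (space (Prob S)) (Filt S) \<and>
     (\<forall>t. sets (Filt S t) \<subseteq> sets (Prob S)) \<and>
     (\<forall>A N. N \<in> null_sets (Prob S) \<longrightarrow> A \<subseteq> N \<longrightarrow> A \<in> sets (Filt S 0)) \<and>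
     (\<forall>t<\<infinity>. sets (Filt S t) = (\<Inter>s\<in>{t<..}. sets (Filt S s)))"

(* The increment density is the product density, i.e. W_t - W_s ~ N(0, (t-s) I). *)
definition brownian_motion :: "'w model \<Rightarrow> bool" where
  "brownian_motion S \<longleftrightarrow>
     adapted S (Bm S) \<and> continuous_paths S (Bm S) \<and>
     (\<forall>\<omega>\<in>space (Prob S). Bm S 0 \<omega> = 0) \<and>
     (\<forall>s t. 0 \<le> s \<longrightarrow> s < t \<longrightarrow>
        distributed (Prob S) lborel (\<lambda>\<omega>. Bm S t \<omega> - Bm S s \<omega>)
          (\<lambda>z. ennreal (\<Prod>i\<in>UNIV. normal_density 0 (sqrt (t - s)) (z $ i))) \<and>
        prob_space.indep_set (Prob S) (sets (Filt S (ennreal s)))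
          (sets (vimage_algebra (space (Prob S)) (\<lambda>\<omega>. Bm S t \<omega> - Bm S s \<omega>) borel)))"

definition augmented_brownian_filtration :: "'w model \<Rightarrow> real \<Rightarrow> 'w measure" where
  "augmented_brownian_filtration S t = sigma (space (Prob S))
     ({Bm S s -` B \<inter> space (Prob S) | s B. 0 \<le> s \<and> s \<le> t \<and> B \<in> sets borel}
       \<union> null_sets (Prob S))"

definition tends_to_infinity :: "'w model \<Rightarrow> (nat \<Rightarrow> 'w \<Rightarrow> ennreal) \<Rightarrow> bool" where
  "tends_to_infinity S \<rho> \<longleftrightarrow>
     (AE \<omega> in Prob S. incseq (\<lambda>k. \<rho> k \<omega>) \<and> (\<lambda>k. \<rho> k \<omega>) \<longlonglongrightarrow> \<infinity>)"

definition martingale :: "'w model \<Rightarrow> (real \<Rightarrow> 'w \<Rightarrow> real) \<Rightarrow> bool" where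
  "martingale S N \<longleftrightarrow> adapted S N \<and> (\<forall>t\<ge>0. integrable (Prob S) (N t)) \<and>
     (\<forall>s t. 0 \<le> s \<longrightarrow> s \<le> t \<longrightarrow>
        (AE \<omega> in Prob S. real_cond_exp (Prob S) (Filt S (ennreal s)) (N t) \<omega> = N s \<omega>))"

definition local_martingale :: "'w model \<Rightarrow> (real \<Rightarrow> 'w \<Rightarrow> real) \<Rightarrow> bool" where
  "local_martingale S N \<longleftrightarrow> adapted S N \<and>
     (AE \<omega> in Prob S. \<forall>t\<ge>0. continuous (at_right t) (\<lambda>s. N s \<omega>)) \<and>
     (\<exists>\<rho>. (\<forall>n. stopping_time (Filt S) (\<rho> n)) \<and> tends_to_infinity S \<rho> \<and>
        (\<forall>n. martingale S (\<lambda>t \<omega>. N (enn2real (min (ennreal t) (\<rho> n \<omega>))) \<omega> - N 0 \<omega>)))"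

definition uniformly_integrable :: "'w measure \<Rightarrow> (nat \<Rightarrow> 'w \<Rightarrow> real) \<Rightarrow> bool" where
  "uniformly_integrable M Z \<longleftrightarrow> (\<forall>k. integrable M (Z k)) \<and>
     (\<forall>\<epsilon>>0. \<exists>K. \<forall>k. (LINT \<omega>:{\<omega>\<in>space M. \<bar>Z k \<omega>\<bar> > K}|M. \<bar>Z k \<omega>\<bar>) \<le> \<epsilon>)"


subsection \<open>Ito integral\<close>

definition tends_to_zero_in_prob :: "'w measure \<Rightarrow> (nat \<Rightarrow> 'w \<Rightarrow> ennreal) \<Rightarrow> bool" where
  "tends_to_zero_in_prob M Z \<longleftrightarrow>
     (\<forall>\<epsilon>>0. (\<lambda>n. emeasure M {\<omega>\<in>space M. Z n \<omega> > \<epsilon>}) \<longlonglongrightarrow> 0)"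

(* (m, t, xi) encodes the process  sum_{i<m} xi_i 1_(t_i, t_{i+1}]. *)
type_synonym 'w simple_process = "nat \<times> (nat \<Rightarrow> real) \<times> (nat \<Rightarrow> 'w \<Rightarrow> real)"

definition simple_predictable :: "'w model \<Rightarrow> 'w simple_process \<Rightarrow> bool" where
  "simple_predictable S = (\<lambda>(m, t, \<xi>). 0 \<le> t 0 \<and> (\<forall>i<m. t i \<le> t (Suc i)) \<and>
     (\<forall>i<m. \<xi> i \<in> borel_measurable (Filt S (ennreal (t i))) \<and>
        (\<exists>C. \<forall>\<omega>\<in>space (Prob S). \<bar>\<xi> i \<omega>\<bar> \<le> C)))"

definition simple_value :: "'w simple_process \<Rightarrow> real \<Rightarrow> 'w \<Rightarrow> real" where
  "simple_value = (\<lambda>(m, t, \<xi>) s \<omega>. \<Sum>i<m. \<xi> i \<omega> * indicator {t i <.. t (Suc i)} s)"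

definition simple_integral :: "(real \<Rightarrow> 'w \<Rightarrow> real) \<Rightarrow> 'w simple_process \<Rightarrow> real \<Rightarrow> 'w \<Rightarrow> real" where
  "simple_integral B = (\<lambda>(m, t, \<xi>) s \<omega>.
     \<Sum>i<m. \<xi> i \<omega> * (B (min (t (Suc i)) s) \<omega> - B (min (t i) s) \<omega>))"

(* I_t = int_0^t H dB for a scalar Brownian motion B and a progressive H that is locally square
   integrable almost surely: the limit, locally uniformly in probability, of integrals of simple
   processes that approximate H in L2 on bounded time intervals, in probability. *)
definition is_ito_integral ::
  "'w model \<Rightarrow> (real \<Rightarrow> 'w \<Rightarrow> real) \<Rightarrow> (real \<Rightarrow> 'w \<Rightarrow> real) \<Rightarrow> (real \<Rightarrow> 'w \<Rightarrow> real) \<Rightarrow> bool" where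
  "is_ito_integral S B H I \<longleftrightarrow>
     progressive S H \<and>
     (AE \<omega> in Prob S. \<forall>T\<ge>0. (\<integral>\<^sup>+s\<in>{0..T}. ennreal ((H s \<omega>)\<^sup>2) \<partial>lborel) < \<infinity>) \<and>
     adapted S I \<and> continuous_paths S I \<and>
     (\<exists>\<Phi>. (\<forall>n. simple_predictable S (\<Phi> n)) \<and> (\<forall>T\<ge>0.
        tends_to_zero_in_prob (Prob S) (\<lambda>n \<omega>.
          \<integral>\<^sup>+s\<in>{0..T}. ennreal ((simple_value (\<Phi> n) s \<omega> - H s \<omega>)\<^sup>2) \<partial>lborel) \<and>
        tends_to_zero_in_prob (Prob S) (\<lambda>n \<omega>.
          SUP t\<in>{0..T}. ennreal \<bar>simple_integral B (\<Phi> n) t \<omega> - I t \<omega>\<bar>)))"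


subsection \<open>Pathwise Stieltjes integrals\<close>

(* The measure df on [0,\<infinity>) of a continuous non-decreasing path f; times < 0 carry no mass. *)
definition path_measure :: "(real \<Rightarrow> real) \<Rightarrow> real measure" where
  "path_measure f = interval_measure (\<lambda>t. f (max 0 t))"

definition continuous_increasing :: "(real \<Rightarrow> real) \<Rightarrow> bool" where
  "continuous_increasing f \<longleftrightarrow> continuous_on {0..} f \<and> mono_on {0..} f"

(* int_T h df for a path f of locally bounded variation, via a decomposition f = P - N into
   continuous non-decreasing paths; the value does not depend on the decomposition. *)
definition has_stieltjes_integral ::
  "(real \<Rightarrow> real) \<Rightarrow> real set \<Rightarrow> (real \<Rightarrow> real) \<Rightarrow> real \<Rightarrow> bool" where
  "has_stieltjes_integral f T h v \<longleftrightarrow>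
     (\<exists>P N. continuous_increasing P \<and> continuous_increasing N \<and> (\<forall>t\<ge>0. f t = P t - N t) \<and>
        set_integrable (path_measure P) T h \<and> set_integrable (path_measure N) T h \<and>
        v = (LINT s:T|path_measure P. h s) - (LINT s:T|path_measure N. h s))"

definition stieltjes_integral :: "(real \<Rightarrow> real) \<Rightarrow> real set \<Rightarrow> (real \<Rightarrow> real) \<Rightarrow> real" where
  "stieltjes_integral f T h = (THE v. has_stieltjes_integral f T h v)"

(* [0, t] for an extended time t; equals [0,\<infinity>) when t = \<infinity>. *)
definition upto_time :: "ennreal \<Rightarrow> real set" where
  "upto_time t = {s. 0 \<le> s \<and> ennreal s \<le> t}"


subsection \<open>Normally reflected diffusion and local time\<close>

definition reflected_solution ::
  "'w model \<Rightarrow> real^2 \<Rightarrow> (real \<Rightarrow> 'w \<Rightarrow> real^2) \<Rightarrow> (real \<Rightarrow> 'w \<Rightarrow> real^2) \<Rightarrow> bool" where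
  "reflected_solution S x X L \<longleftrightarrow>
     adapted S X \<and> continuous_paths S X \<and> adapted S L \<and> continuous_paths S L \<and>
     (\<forall>\<omega>\<in>space (Prob S). (\<forall>t\<ge>0. X t \<omega> \<in> quadrant) \<and> L 0 \<omega> = 0 \<and>
        (\<forall>i. mono_on {0..} (\<lambda>t. L t \<omega> $ i))) \<and>
     (\<forall>i. AE \<omega> in Prob S.
        (\<integral>\<^sup>+s\<in>{0..}. indicator {s. X s \<omega> $ i > 0} s \<partial>path_measure (\<lambda>t. L t \<omega> $ i)) = 0) \<and>
     (\<exists>J. (\<forall>i j. is_ito_integral S (\<lambda>t \<omega>. Bm S t \<omega> $ j) (\<lambda>t \<omega>. disp S (X t \<omega>) $ i $ j) (J i j)) \<and>
        (\<forall>i. AE \<omega> in Prob S. \<forall>t\<ge>0.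
           X t \<omega> $ i = x $ i + (LINT s:{0..t}|lborel. drift S (X s \<omega>) $ i)
             + (\<Sum>j\<in>UNIV. J i j t \<omega>) + L t \<omega> $ i))"

definition unique_strong_solution :: "'w model \<Rightarrow> real^2 \<Rightarrow> bool" where
  "unique_strong_solution S x \<longleftrightarrow>
     reflected_solution S x (flow S x) (push S x) \<and>
     (\<forall>t\<ge>0. flow S x t \<in> borel_measurable (augmented_brownian_filtration S t)) \<and>
     (\<forall>X L. reflected_solution S x X L \<longrightarrow>
        (AE \<omega> in Prob S. \<forall>t\<ge>0. X t \<omega> = flow S x t \<omega> \<and> L t \<omega> = push S x t \<omega>))"

definition strong_markov :: "'w model \<Rightarrow> bool" where
  "strong_markov S \<longleftrightarrow>
     (\<forall>(f :: real^2 \<Rightarrow> real) t. f \<in> borel_measurable borel \<longrightarrow> bounded (range f) \<longrightarrow> 0 \<le> t \<longrightarrow>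
        (\<lambda>y. LINT \<omega>|Prob S. f (flow S y t \<omega>)) \<in> borel_measurable (restrict_space borel quadrant) \<and>
        (\<forall>x\<in>quadrant. \<forall>\<tau>. stopping_time (Filt S) \<tau> \<longrightarrow>
           (AE \<omega> in Prob S.
              real_cond_exp (Prob S) (filtration.pre_sigma (space (Prob S)) (Filt S) \<tau>)
                (\<lambda>\<omega>. if \<tau> \<omega> < \<infinity> then f (flow S x (enn2real (\<tau> \<omega>) + t) \<omega>) else 0) \<omega>
              = (if \<tau> \<omega> < \<infinity>
                 then LINT \<omega>'|Prob S. f (flow S (flow S x (enn2real (\<tau> \<omega>)) \<omega>) t \<omega>') else 0))))"

definition contact_process :: "'w model \<Rightarrow> real^2 \<Rightarrow> real \<Rightarrow> 'w \<Rightarrow> real" where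
  "contact_process S x t \<omega> = flow S x t \<omega> $ 1 - slope S * flow S x t \<omega> $ 2"

(* The local time at 0 of Y = X^1 - alpha X^2: the continuous non-decreasing process in Tanaka's
   formula |Y_t| = |Y_0| + int_0^t sgn(Y) dY + l_t, with dY expanded by the equation for X.
   Here sgn 0 = 0. By ellipticity the choice of sgn 0 can only matter for the dL^i terms, and there
   only while X sits at the origin. *)
definition is_local_time :: "'w model \<Rightarrow> real^2 \<Rightarrow> (real \<Rightarrow> 'w \<Rightarrow> real) \<Rightarrow> bool" where
  "is_local_time S x l \<longleftrightarrow>
     adapted S l \<and>
     (\<forall>\<omega>\<in>space (Prob S). continuous_increasing (\<lambda>t. l t \<omega>) \<and> l 0 \<omega> = 0) \<and>
     (\<exists>J. (\<forall>j. is_ito_integral S (\<lambda>t \<omega>. Bm S t \<omega> $ j)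
              (\<lambda>t \<omega>. sgn (contact_process S x t \<omega>)
                 * (disp S (flow S x t \<omega>) $ 1 $ j - slope S * disp S (flow S x t \<omega>) $ 2 $ j)) (J j)) \<and>
        (AE \<omega> in Prob S. \<forall>t\<ge>0.
           \<bar>contact_process S x t \<omega>\<bar> = \<bar>contact_process S x 0 \<omega>\<bar>
             + (LINT s:{0..t}|lborel. sgn (contact_process S x s \<omega>)
                  * (drift S (flow S x s \<omega>) $ 1 - slope S * drift S (flow S x s \<omega>) $ 2))
             + (\<Sum>j\<in>UNIV. J j t \<omega>)
             + (LINT s:{0..t}|path_measure (\<lambda>u. push S x u \<omega> $ 1). sgn (contact_process S x s \<omega>))
             - slope S * (LINT s:{0..t}|path_measure (\<lambda>u. push S x u \<omega> $ 2).
                  sgn (contact_process S x s \<omega>))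
             + l t \<omega>))"


subsection \<open>Optimal stopping problem\<close>

definition gain :: "'w model \<Rightarrow> real^2 \<Rightarrow> real" where
  "gain S x = max (x $ 1) (slope S * x $ 2)"

definition reward :: "'w model \<Rightarrow> real^2 \<Rightarrow> ('w \<Rightarrow> ennreal) \<Rightarrow> 'w \<Rightarrow> real" where
  "reward S x \<tau> \<omega> = (if \<tau> \<omega> = \<infinity> then 0
     else exp (- rate S * enn2real (\<tau> \<omega>)) * gain S (flow S x (enn2real (\<tau> \<omega>)) \<omega>))"

definition running_cost :: "'w model \<Rightarrow> real^2 \<Rightarrow> ('w \<Rightarrow> ennreal) \<Rightarrow> 'w \<Rightarrow> real" where
  "running_cost S x \<tau> \<omega> =
     (LINT s:upto_time (\<tau> \<omega>)|lborel. exp (- rate S * s) * cost S (flow S x s \<omega>))"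

definition payoff :: "'w model \<Rightarrow> real^2 \<Rightarrow> ('w \<Rightarrow> ennreal) \<Rightarrow> 'w \<Rightarrow> real" where
  "payoff S x \<tau> \<omega> = reward S x \<tau> \<omega> - running_cost S x \<tau> \<omega>"

(* The stopping times considered: both payoff terms are integrable. Stopping times with infinite
   expected cost but integrable reward have payoff -\<infinity> and do not affect the supremum. *)
definition admissible_times :: "'w model \<Rightarrow> real^2 \<Rightarrow> ('w \<Rightarrow> ennreal) set" where
  "admissible_times S x = {\<tau>. stopping_time (Filt S) \<tau> \<and> integrable (Prob S) (reward S x \<tau>) \<and>
     (\<integral>\<^sup>+\<omega>. (\<integral>\<^sup>+s\<in>upto_time (\<tau> \<omega>). ennreal (exp (- rate S * s) * cost S (flow S x s \<omega>)) \<partial>lborel)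
        \<partial>Prob S) < \<infinity>}"

definition value_fun :: "'w model \<Rightarrow> real^2 \<Rightarrow> real" where
  "value_fun S x = (SUP \<tau>\<in>admissible_times S x. LINT \<omega>|Prob S. payoff S x \<tau> \<omega>)"

definition stopping_region :: "'w model \<Rightarrow> (real^2) set" where
  "stopping_region S = {x\<in>quadrant. value_fun S x = gain S x}"

definition hitting_time :: "'w model \<Rightarrow> real^2 \<Rightarrow> 'w \<Rightarrow> ennreal" where
  "hitting_time S x \<omega> = Inf (ennreal ` {t. 0 \<le> t \<and> flow S x t \<omega> \<in> stopping_region S})"

definition hitting_time_optimal :: "'w model \<Rightarrow> real^2 \<Rightarrow> bool" where
  "hitting_time_optimal S x \<longleftrightarrow> hitting_time S x \<in> admissible_times S x \<and>
     value_fun S x = (LINT \<omega>|Prob S. payoff S x (hitting_time S x) \<omega>)"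


subsection \<open>Stopping gain and killed resolvent\<close>

(* The value on the Lebesgue null line x_1 = alpha x_2 is immaterial. *)
definition gamma_ac :: "'w model \<Rightarrow> real^2 \<Rightarrow> real" where
  "gamma_ac S x =
     (if x $ 1 > slope S * x $ 2 then cost S x + rate S * x $ 1 - drift S x $ 1
      else if x $ 1 < slope S * x $ 2
      then cost S x + rate S * slope S * x $ 2 - slope S * drift S x $ 2
      else 0)"

definition contact_variance :: "'w model \<Rightarrow> real^2 \<Rightarrow> real" where
  "contact_variance S x = diffusion_matrix S x $ 1 $ 1 - 2 * slope S * diffusion_matrix S x $ 1 $ 2
     + (slope S)\<^sup>2 * diffusion_matrix S x $ 2 $ 2"

(* Arc length on the ray x_1 = alpha x_2 in the quadrant, by its unit speed parametrisation. *)
definition arc_length :: "'w model \<Rightarrow> (real^2) measure" where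
  "arc_length S = distr (restrict_space lborel {0..}) borel
     (\<lambda>s. (s / sqrt (1 + (slope S)\<^sup>2)) *\<^sub>R vector [slope S, 1])"

(* Positive and negative parts of Gamma = Gamma^ac dx + Gamma^Delta: the two summands are mutually
   singular and Gamma^Delta is a negative measure. *)
definition gamma_pos :: "'w model \<Rightarrow> (real^2) measure" where
  "gamma_pos S = density lborel (\<lambda>x. ennreal (max 0 (gamma_ac S x)) * indicator quadrant x)"

definition gamma_neg :: "'w model \<Rightarrow> (real^2) measure" where
  "gamma_neg S = measure_of UNIV (sets borel) (\<lambda>B.
     emeasure (density lborel (\<lambda>x. ennreal (max 0 (- gamma_ac S x)) * indicator quadrant x)) B
     + emeasure (density (arc_length S)
         (\<lambda>x. ennreal (contact_variance S x / (2 * sqrt (1 + (slope S)\<^sup>2)))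
           * indicator quadrant x)) B)"

definition polar :: "'w model \<Rightarrow> (real^2) set \<Rightarrow> bool" where
  "polar S B \<longleftrightarrow> (\<forall>x\<in>quadrant. AE \<omega> in Prob S. \<forall>t>0. flow S x t \<omega> \<notin> B)"

(* Smooth measures of the process X: no polar set is charged, and there is an increasing sequence of
   closed sets of finite measure which exhausts the measure and is a nest: for every compact K the
   hitting times of K - F_n increase to \<infinity>, for quasi every starting point. *)
definition smooth_measure :: "'w model \<Rightarrow> (real^2) measure \<Rightarrow> bool" where
  "smooth_measure S \<nu> \<longleftrightarrow> sets \<nu> = sets borel \<and> emeasure \<nu> (- quadrant) = 0 \<and>
     (\<forall>B\<in>sets borel. B \<subseteq> quadrant \<longrightarrow> polar S B \<longrightarrow> emeasure \<nu> B = 0) \<and>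
     (\<exists>F :: nat \<Rightarrow> (real^2) set. incseq F \<and>
        (\<forall>n. closed (F n) \<and> F n \<subseteq> quadrant \<and> emeasure \<nu> (F n) < \<infinity>) \<and>
        emeasure \<nu> (quadrant - (\<Union>n. F n)) = 0 \<and>
        (\<forall>K. compact K \<longrightarrow> K \<subseteq> quadrant \<longrightarrow>
           (\<exists>E. polar S E \<and> (\<forall>x\<in>quadrant - E. AE \<omega> in Prob S.
              (\<lambda>n. Inf (ennreal ` {t. 0 < t \<and> flow S x t \<omega> \<in> K - F n})) \<longlonglongrightarrow> \<infinity>))))"

(* A^Gamma, and the positive continuous additive functionals of Gamma^+ and Gamma^-. *)
definition A_gamma :: "'w model \<Rightarrow> real^2 \<Rightarrow> real \<Rightarrow> 'w \<Rightarrow> real" where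
  "A_gamma S x t \<omega> =
     (LINT s:{0..t}|lborel. gamma_ac S (flow S x s \<omega>)) - 1 / 2 * loctime S x t \<omega>"

definition A_gamma_pos :: "'w model \<Rightarrow> real^2 \<Rightarrow> real \<Rightarrow> 'w \<Rightarrow> real" where
  "A_gamma_pos S x t \<omega> = (LINT s:{0..t}|lborel. max 0 (gamma_ac S (flow S x s \<omega>)))"

definition A_gamma_neg :: "'w model \<Rightarrow> real^2 \<Rightarrow> real \<Rightarrow> 'w \<Rightarrow> real" where
  "A_gamma_neg S x t \<omega> =
     (LINT s:{0..t}|lborel. max 0 (- gamma_ac S (flow S x s \<omega>))) + 1 / 2 * loctime S x t \<omega>"

definition discounted_integral ::
  "'w model \<Rightarrow> (real^2 \<Rightarrow> real \<Rightarrow> 'w \<Rightarrow> real) \<Rightarrow> real^2 \<Rightarrow> ennreal \<Rightarrow> 'w \<Rightarrow> real" where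
  "discounted_integral S A x t \<omega> =
     stieltjes_integral (\<lambda>u. A x u \<omega>) (upto_time t) (\<lambda>s. exp (- rate S * s))"

(* The killed resolvent of the measure whose additive functional is A. *)
definition killed_resolvent :: "'w model \<Rightarrow> (real^2 \<Rightarrow> real \<Rightarrow> 'w \<Rightarrow> real) \<Rightarrow> real^2 \<Rightarrow> real" where
  "killed_resolvent S A x = (LINT \<omega>|Prob S. discounted_integral S A x (hitting_time S x \<omega>) \<omega>)"

(* The same for non-decreasing A, with values in [0,\<infinity>]. *)
definition killed_resolvent_nn ::
  "'w model \<Rightarrow> (real^2 \<Rightarrow> real \<Rightarrow> 'w \<Rightarrow> real) \<Rightarrow> real^2 \<Rightarrow> ennreal" where
  "killed_resolvent_nn S A x =
     (\<integral>\<^sup>+\<omega>. (\<integral>\<^sup>+s\<in>upto_time (hitting_time S x \<omega>). ennreal (exp (- rate S * s))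
        \<partial>path_measure (\<lambda>u. A x u \<omega>)) \<partial>Prob S)"

definition admissible_potential :: "'w model \<Rightarrow> real^2 \<Rightarrow> bool" where
  "admissible_potential S x \<longleftrightarrow> smooth_measure S (gamma_pos S) \<and> smooth_measure S (gamma_neg S) \<and>
     killed_resolvent_nn S (A_gamma_pos S) x + killed_resolvent_nn S (A_gamma_neg S) x < \<infinity>"


subsection \<open>Standing assumptions\<close>

definition coefficient_regularity :: "'w model \<Rightarrow> bool" where
  "coefficient_regularity S \<longleftrightarrow>
     (\<forall>x\<in>quadrant. \<exists>u>0. \<exists>C. C-lipschitz_on (cball x u \<inter> quadrant) (drift S) \<and>
        C-lipschitz_on (cball x u \<inter> quadrant) (disp S)) \<and>
     (\<exists>C. \<forall>x\<in>quadrant. norm (drift S x) + norm (disp S x) \<le> C * (1 + norm x))"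

definition locally_uniformly_elliptic :: "'w model \<Rightarrow> bool" where
  "locally_uniformly_elliptic S \<longleftrightarrow>
     (\<forall>K. compact K \<longrightarrow> K \<subseteq> quadrant \<longrightarrow> (\<exists>m>0. \<forall>x\<in>K. \<forall>\<xi> :: real^2.
        \<xi> \<bullet> (diffusion_matrix S x *v \<xi>) \<ge> m * (norm \<xi>)\<^sup>2))"

definition flow_continuity :: "'w model \<Rightarrow> bool" where
  "flow_continuity S \<longleftrightarrow>
     (\<forall>T>0. \<forall>K. compact K \<longrightarrow> K \<subseteq> quadrant \<longrightarrow>
        (\<exists>q::real. q \<ge> 1 \<and> (\<forall>\<epsilon>>0. \<exists>\<delta>>0. \<forall>x\<in>K. \<forall>y\<in>quadrant. dist y x < \<delta> \<longrightarrow>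
           (\<integral>\<^sup>+\<omega>. (SUP t\<in>{0..T}. ennreal (norm (flow S y t \<omega> - flow S x t \<omega>) powr q)) \<partial>Prob S)
             < ennreal \<epsilon>)))"

definition value_growth :: "'w model \<Rightarrow> bool" where
  "value_growth S \<longleftrightarrow>
     (\<forall>x\<in>quadrant. bdd_above ((\<lambda>\<tau>. LINT \<omega>|Prob S. payoff S x \<tau> \<omega>) ` admissible_times S x)) \<and>
     (\<exists>C p. 0 \<le> p \<and> (\<forall>x\<in>quadrant. 0 \<le> value_fun S x \<and> value_fun S x \<le> C * (1 + norm x powr p)))"

definition standing_assumptions :: "'w model \<Rightarrow> bool" where
  "standing_assumptions S \<longleftrightarrow>
     usual_conditions S \<and> brownian_motion S \<and> rate S > 0 \<and> slope S > 0 \<and>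
     coefficient_regularity S \<and>
     locally_uniformly_elliptic S \<and>
     (\<forall>x\<in>quadrant. unique_strong_solution S x) \<and> strong_markov S \<and>
     flow_continuity S \<and>
     continuous_on quadrant (cost S) \<and> (\<forall>x\<in>quadrant. cost S x \<ge> 0) \<and>
     value_growth S \<and>
     (\<forall>x\<in>quadrant. is_local_time S x (loctime S x))"

end

theory Submission
  imports Defs
begin

text \<open>
  Along \<open>\<theta> k\<close> the Ito-Tanaka identity gives \<open>E[payoff (\<theta> k)] = G(x) - E[\<integral> exp (- r s) dA\<^sub>s]\<close>, the integral
  being over \<open>[0, \<theta> k]\<close>. The left-hand side tends to \<open>V(x)\<close> by uniform integrability. On the right,
  \<open>A\<close> is split into the increasing functionals of \<open>\<Gamma>\<^sup>+\<close> and \<open>\<Gamma>\<^sup>-\<close>; admissibility makes the sum of their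
  discounted masses on \<open>[0, \<tau>\<^sub>D]\<close> an integrable majorant, and dominated convergence applies. A finite
  \<open>\<integral>\<^sup>+\<close> only yields integrability of a measurable function, so the measurability in \<open>\<omega>\<close> of the pathwise
  integrals up to \<open>\<tau>\<^sub>D\<close> has to be established.
\<close>

subsection \<open>Measurability at random times and uniform integrability\<close>

text \<open>Rounding \<open>\<tau>\<close> up to a grid of mesh \<open>1 / (n + 1)\<close> gives
  times with countably many values, where composition is measurable; path continuity carries this to
  the limit. As \<open>M\<close> is arbitrary, it may be a product space whose time coordinate
  serves as \<open>\<tau>\<close>: this is how joint measurability is obtained below.\<close>

lemma measurable_at_random_time:
  fixes f :: "real \<Rightarrow> 'a \<Rightarrow> 'b::metric_space"
  assumes f: "\<And>t. 0 \<le> t \<Longrightarrow> f t \<in> borel_measurable M"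
    and cont: "\<And>\<omega>. \<omega> \<in> space M \<Longrightarrow> continuous_on {0..} (\<lambda>t. f t \<omega>)"
    and \<tau>[measurable]: "\<tau> \<in> borel_measurable M"
    and nonneg: "\<And>\<omega>. \<omega> \<in> space M \<Longrightarrow> 0 \<le> \<tau> \<omega>"
  shows "(\<lambda>\<omega>. f (\<tau> \<omega>) \<omega>) \<in> borel_measurable M"
proof (rule borel_measurable_LIMSEQ_metric)
  let ?t = "\<lambda>n \<omega>. real (nat \<lceil>\<tau> \<omega> * real (Suc n)\<rceil>) / real (Suc n)"
  show "(\<lambda>\<omega>. f (?t n \<omega>) \<omega>) \<in> borel_measurable M" for n
    by (rule measurable_compose_countable[where f = "\<lambda>i \<omega>. f (real i / real (Suc n)) \<omega>"
          and g = "\<lambda>\<omega>. nat \<lceil>\<tau> \<omega> * real (Suc n)\<rceil>"]) (auto intro!: f)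
  fix \<omega> assume \<omega>: "\<omega> \<in> space M"
  have "(\<lambda>n. ?t n \<omega>) \<longlonglongrightarrow> \<tau> \<omega>"
  proof (rule tendsto_sandwich)
    have "\<tau> \<omega> \<le> ?t n \<omega> \<and> ?t n \<omega> \<le> \<tau> \<omega> + inverse (real (Suc n))" for n
    proof -
      \<comment> \<open>Nonnegativity makes \<open>nat\<close> lossless, so the error of the
        rounding lies between 0 and one mesh width.\<close>
      have "0 \<le> \<tau> \<omega> * real (Suc n)" using nonneg[OF \<omega>] by simp
      then have "real (nat \<lceil>\<tau> \<omega> * real (Suc n)\<rceil>) = of_int \<lceil>\<tau> \<omega> * real (Suc n)\<rceil>"
        by (intro of_nat_nat) linarith
      moreover have "\<tau> \<omega> * real (Suc n) \<le> of_int \<lceil>\<tau> \<omega> * real (Suc n)\<rceil>"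
        "of_int \<lceil>\<tau> \<omega> * real (Suc n)\<rceil> \<le> \<tau> \<omega> * real (Suc n) + 1" by linarith+
      ultimately show ?thesis by (simp add: field_simps del: of_nat_Suc)
    qed
    then show "\<forall>\<^sub>F n in sequentially. \<tau> \<omega> \<le> ?t n \<omega>"
      "\<forall>\<^sub>F n in sequentially. ?t n \<omega> \<le> \<tau> \<omega> + inverse (real (Suc n))" by auto
    show "(\<lambda>n. \<tau> \<omega> + inverse (real (Suc n))) \<longlonglongrightarrow> \<tau> \<omega>"
      using tendsto_add[OF tendsto_const LIMSEQ_inverse_real_of_nat, of "\<tau> \<omega>"] by simp
  qed simp
  then show "(\<lambda>n. f (?t n \<omega>) \<omega>) \<longlonglongrightarrow> f (\<tau> \<omega>) \<omega>"
  proof (rule continuous_on_tendsto_compose[OF cont[OF \<omega>]])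
    show "\<forall>\<^sub>F n in sequentially. ?t n \<omega> \<in> {0..}"
      unfolding atLeast_iff by (intro always_eventually allI divide_nonneg_nonneg of_nat_0_le_iff)
  qed (simp add: nonneg[OF \<omega>])
qed

text \<open>Vitali's theorem. Clip at a level \<open>K\<close>: uniform integrability controls the
  clipped-off part of every \<open>Z k\<close>, Fatou that of \<open>Y\<close>, and bounded
  convergence handles the clipped variables.\<close>

lemma uniformly_integrable_tendsto_integral:
  assumes M: "finite_measure M"
    and ui: "uniformly_integrable M Z"
    and Y[measurable]: "Y \<in> borel_measurable M"
    and conv: "AE \<omega> in M. (\<lambda>k. Z k \<omega>) \<longlonglongrightarrow> Y \<omega>"
  shows "integrable M Y" "(\<lambda>k. integral\<^sup>L M (Z k)) \<longlonglongrightarrow> integral\<^sup>L M Y"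
proof -
  interpret finite_measure M by fact
  have Z: "integrable M (Z k)" for k using ui by (auto simp: uniformly_integrable_def)
  then have [measurable]: "Z k \<in> borel_measurable M" for k by auto
  define \<phi> :: "real \<Rightarrow> real \<Rightarrow> real" where "\<phi> K z = max (- K) (min K z)" for K z
  have [measurable]: "\<phi> K \<in> borel_measurable borel" for K unfolding \<phi>_def by measurable
  \<comment> \<open>One level \<open>K\<close> has to serve all \<open>Z k\<close> and the limit at
    once.\<close>
  have clip: "\<exists>K\<ge>0. (\<forall>k. (LINT \<omega>|M. \<bar>Z k \<omega> - \<phi> K (Z k \<omega>)\<bar>) \<le> \<epsilon>) \<and>
      integrable M (\<lambda>\<omega>. Y \<omega> - \<phi> K (Y \<omega>)) \<and> (LINT \<omega>|M. \<bar>Y \<omega> - \<phi> K (Y \<omega>)\<bar>) \<le> \<epsilon>"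
    if "\<epsilon> > 0" for \<epsilon>
  proof -
    obtain K' where K': "\<And>k. (LINT \<omega>:{\<omega>\<in>space M. \<bar>Z k \<omega>\<bar> > K'}|M. \<bar>Z k \<omega>\<bar>) \<le> \<epsilon>"
      using ui \<open>\<epsilon> > 0\<close> unfolding uniformly_integrable_def by blast
    \<comment> \<open>The level \<open>K'\<close> may be negative, and then \<open>\<phi> K'\<close>
      would not be a clip. Raising it to 0 is harmless: \<open>Z k\<close> differs from
      \<open>\<phi> K (Z k)\<close> only where its modulus exceeds \<open>K\<close>, hence
      \<open>K'\<close>, and there by at most that modulus.\<close>
    define K where "K = max 0 K'"
    have K: "0 \<le> K" by (simp add: K_def)
    have \<phi>_bound: "\<bar>\<phi> K z\<bar> \<le> K" for z using K by (auto simp: \<phi>_def)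
    have \<phi>_int: "integrable M (\<lambda>\<omega>. \<phi> K (Z k \<omega>))" for k
      by (rule integrable_const_bound[where B = K]) (auto simp: \<phi>_bound)
    have le: "(LINT \<omega>|M. \<bar>Z k \<omega> - \<phi> K (Z k \<omega>)\<bar>) \<le> \<epsilon>" for k
    proof -
      have "(LINT \<omega>|M. \<bar>Z k \<omega> - \<phi> K (Z k \<omega>)\<bar>)
          \<le> (LINT \<omega>:{\<omega>\<in>space M. \<bar>Z k \<omega>\<bar> > K'}|M. \<bar>Z k \<omega>\<bar>)"
        unfolding set_lebesgue_integral_def
      proof (rule integral_mono)
        show "integrable M (\<lambda>\<omega>. \<bar>Z k \<omega> - \<phi> K (Z k \<omega>)\<bar>)" using Z \<phi>_int by auto
        show "integrable M (\<lambda>\<omega>. indicator {\<omega>\<in>space M. \<bar>Z k \<omega>\<bar> > K'} \<omega> *\<^sub>R \<bar>Z k \<omega>\<bar>)"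
          using Z by (intro integrable_mult_indicator) auto
      qed (auto simp: indicator_def \<phi>_def K_def)
      with K' show ?thesis by (meson order_trans)
    qed
    \<comment> \<open>Fatou's lemma with nonnegative integrals, since the integrability of
      \<open>Y\<close> is not known yet and is deduced from this bound.\<close>
    have "(\<integral>\<^sup>+\<omega>. ennreal \<bar>Y \<omega> - \<phi> K (Y \<omega>)\<bar> \<partial>M)
        = (\<integral>\<^sup>+\<omega>. liminf (\<lambda>k. ennreal \<bar>Z k \<omega> - \<phi> K (Z k \<omega>)\<bar>) \<partial>M)"
    proof (rule nn_integral_cong_AE, use conv in eventually_elim)
      fix \<omega> assume "(\<lambda>k. Z k \<omega>) \<longlonglongrightarrow> Y \<omega>"
      then have "(\<lambda>k. ennreal \<bar>Z k \<omega> - \<phi> K (Z k \<omega>)\<bar>) \<longlonglongrightarrow> ennreal \<bar>Y \<omega> - \<phi> K (Y \<omega>)\<bar>"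
        unfolding \<phi>_def by (intro tendsto_intros)
      then show "ennreal \<bar>Y \<omega> - \<phi> K (Y \<omega>)\<bar> = liminf (\<lambda>k. ennreal \<bar>Z k \<omega> - \<phi> K (Z k \<omega>)\<bar>)"
        by (intro lim_imp_Liminf[symmetric]) simp_all
    qed
    also have "\<dots> \<le> liminf (\<lambda>k. \<integral>\<^sup>+\<omega>. ennreal \<bar>Z k \<omega> - \<phi> K (Z k \<omega>)\<bar> \<partial>M)"
      by (rule nn_integral_liminf) measurable
    also have "\<dots> \<le> liminf (\<lambda>k::nat. ennreal \<epsilon>)"
      using le Z \<phi>_int by (intro Liminf_mono always_eventually allI) (auto simp: nn_integral_eq_integral ennreal_leI)
    also have "\<dots> = ennreal \<epsilon>" by (simp add: Liminf_const)
    finally have nn: "(\<integral>\<^sup>+\<omega>. ennreal \<bar>Y \<omega> - \<phi> K (Y \<omega>)\<bar> \<partial>M) \<le> ennreal \<epsilon>" .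
    then have int: "integrable M (\<lambda>\<omega>. Y \<omega> - \<phi> K (Y \<omega>))"
      by (intro integrableI_bounded) (auto intro: le_less_trans)
    with nn have "(LINT \<omega>|M. \<bar>Y \<omega> - \<phi> K (Y \<omega>)\<bar>) \<le> \<epsilon>"
      using \<open>\<epsilon> > 0\<close> by (subst (asm) nn_integral_eq_integral) auto
    with K le int show ?thesis by blast
  qed
  obtain K where K: "K \<ge> 0" "integrable M (\<lambda>\<omega>. Y \<omega> - \<phi> K (Y \<omega>))" using clip[of 1] by auto
  have "integrable M (\<lambda>\<omega>. \<phi> K (Y \<omega>))"
    using K(1) by (intro integrable_const_bound[where B = K]) (auto simp: \<phi>_def)
  from Bochner_Integration.integrable_add[OF K(2) this] show Yint: "integrable M Y" by simp
  show "(\<lambda>k. integral\<^sup>L M (Z k)) \<longlonglongrightarrow> integral\<^sup>L M Y"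
  proof (rule LIMSEQ_I)
    \<comment> \<open>Three errors of at most \<open>e / 4\<close> are added: clipping
      \<open>Z k\<close>, clipping \<open>Y\<close>, and the distance between the clipped
      means.\<close>
    fix e :: real assume "e > 0"
    then obtain K where K: "K \<ge> 0" "\<And>k. (LINT \<omega>|M. \<bar>Z k \<omega> - \<phi> K (Z k \<omega>)\<bar>) \<le> e / 4"
      "(LINT \<omega>|M. \<bar>Y \<omega> - \<phi> K (Y \<omega>)\<bar>) \<le> e / 4" using clip[of "e / 4"] by auto
    have \<phi>_bound: "\<bar>\<phi> K z\<bar> \<le> K" for z using K by (auto simp: \<phi>_def)
    have i: "integrable M (\<lambda>\<omega>. \<phi> K (f \<omega>))" if "f \<in> borel_measurable M" for f
      using that by (intro integrable_const_bound[where B = K]) (auto simp: \<phi>_bound)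
    have d: "\<bar>(LINT \<omega>|M. f \<omega>) - (LINT \<omega>|M. \<phi> K (f \<omega>))\<bar> \<le> (LINT \<omega>|M. \<bar>f \<omega> - \<phi> K (f \<omega>)\<bar>)"
      if "integrable M f" for f
      using integral_abs_bound[of M "\<lambda>\<omega>. f \<omega> - \<phi> K (f \<omega>)"]
      by (simp add: Bochner_Integration.integral_diff that i borel_measurable_integrable)
    have "(\<lambda>k. LINT \<omega>|M. \<phi> K (Z k \<omega>)) \<longlonglongrightarrow> (LINT \<omega>|M. \<phi> K (Y \<omega>))"
    proof (rule integral_dominated_convergence[where w = "\<lambda>_. K"])
      show "AE \<omega> in M. (\<lambda>k. \<phi> K (Z k \<omega>)) \<longlonglongrightarrow> \<phi> K (Y \<omega>)"
        using conv by eventually_elim (auto simp: \<phi>_def intro!: tendsto_intros)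
    qed (auto simp: \<phi>_bound)
    from LIMSEQ_D[OF this, of "e / 4"] \<open>e > 0\<close> obtain n where n:
      "\<And>k. n \<le> k \<Longrightarrow> \<bar>(LINT \<omega>|M. \<phi> K (Z k \<omega>)) - (LINT \<omega>|M. \<phi> K (Y \<omega>))\<bar> < e / 4" by auto
    show "\<exists>n. \<forall>k\<ge>n. norm (integral\<^sup>L M (Z k) - integral\<^sup>L M Y) < e"
    proof (intro exI allI impI)
      fix k assume "n \<le> k"
      show "norm (integral\<^sup>L M (Z k) - integral\<^sup>L M Y) < e"
        using n[OF \<open>n \<le> k\<close>] d[OF Z[of k]] K(2)[of k] d[OF Yint] K(3) \<open>e > 0\<close>
        unfolding real_norm_def by linarith
    qed
  qed
qed

text \<open>Continuity is that of the indefinite gauge integral, with which the Lebesgue integral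
  agrees on compact intervals; monotonicity comes from the sign of \<open>g\<close>.\<close>

lemma continuous_increasing_indefinite_integral:
  fixes g :: "real \<Rightarrow> real"
  assumes g: "\<And>T. 0 \<le> T \<Longrightarrow> set_integrable lborel {0..T} g" and nonneg: "\<And>s. 0 \<le> g s"
  shows "continuous_increasing (\<lambda>t. LINT s:{0..t}|lborel. g s)"
  unfolding continuous_increasing_def
proof
  have eq: "(LINT s:{0..t}|lborel. g s) = integral {0..t} g" if "0 \<le> t" for t
    using set_borel_integral_eq_integral[OF g[OF that]] by auto
  \<comment> \<open>The extension by \<open>max 0\<close> gives each \<open>t\<close>, including 0,
    a two-sided neighbourhood that is mapped into the compact interval on which continuity is
    known.\<close>
  have "isCont (\<lambda>t. LINT s:{0..max 0 t}|lborel. g s) t" for t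
  proof -
    have "continuous_on {0..\<bar>t\<bar> + 1} (\<lambda>t. integral {0..t} g)"
      by (intro indefinite_integral_continuous_1 set_borel_integral_eq_integral g) auto
    then have "continuous_on {- \<bar>t\<bar> - 1<..<\<bar>t\<bar> + 1} (\<lambda>t. integral {0..max 0 t} g)"
      by (rule continuous_on_compose2) (auto intro!: continuous_intros)
    moreover have "t \<in> {- \<bar>t\<bar> - 1<..<\<bar>t\<bar> + 1}" by auto
    ultimately show ?thesis
      by (simp add: eq continuous_on_eq_continuous_at)
  qed
  then have "continuous_on UNIV (\<lambda>t. LINT s:{0..max 0 t}|lborel. g s)"
    by (simp add: continuous_at_imp_continuous_on)
  then show "continuous_on {0..} (\<lambda>t. LINT s:{0..t}|lborel. g s)"
    by (rule continuous_on_eq[OF continuous_on_subset]) auto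
  show "mono_on {0..} (\<lambda>t. LINT s:{0..t}|lborel. g s)"
    unfolding set_lebesgue_integral_def
    by (intro mono_onI integral_mono g[unfolded set_integrable_def])
      (auto simp: nonneg indicator_def)
qed

text \<open>The preimages under \<open>f\<close> and \<open>g\<close> differ by a subset of a null
  set, which completeness makes measurable. This serves for \<open>stieltjes_integral\<close>, whose
  definition by \<open>THE\<close> shows no measurability in \<open>\<omega>\<close>.\<close>

lemma (in complete_measure) measurable_if_AE_eq:
  assumes f: "f \<in> M \<rightarrow>\<^sub>M N" and eq: "AE x in M. f x = g x" and g: "g \<in> space M \<rightarrow> space N"
  shows "g \<in> M \<rightarrow>\<^sub>M N"
proof (rule measurableI)
  fix B assume B: "B \<in> sets N"
  show "g -` B \<inter> space M \<in> sets M"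
    by (rule in_sets_AE[OF _ measurable_sets[OF f B]]) (use eq in auto)
qed (use g in auto)

subsection \<open>Discounted Stieltjes integrals\<close>

lemma sets_path_measure [simp, measurable_cong]: "sets (path_measure P) = sets borel"
  by (simp add: path_measure_def)

lemma space_path_measure [simp]: "space (path_measure P) = UNIV"
  by (simp add: path_measure_def)

text \<open>Restates the hypothesis for the extended path inside \<open>path_measure\<close>, as
  interval measures need a distribution function on the whole line.\<close>

lemma continuous_increasing_max:
  assumes "continuous_increasing P"
  shows "continuous_on UNIV (\<lambda>t. P (max 0 t))" "s \<le> t \<Longrightarrow> P (max 0 s) \<le> P (max 0 t)"
proof -
  have "continuous_on {0..} P" "mono_on {0..} P"
    using assms by (auto simp: continuous_increasing_def)
  then show "continuous_on UNIV (\<lambda>t. P (max 0 t))" "s \<le> t \<Longrightarrow> P (max 0 s) \<le> P (max 0 t)"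
    by (auto intro!: continuous_on_compose2[of "{0..}" P] continuous_intros elim!: mono_onD)
qed

lemma sigma_finite_path_measure:
  assumes "continuous_increasing P"
  shows "sigma_finite_measure (path_measure P)"
  unfolding path_measure_def
proof (rule sigma_finite_interval_measure)
  show "continuous (at_right a) (\<lambda>t. P (max 0 t))" for a
    using continuous_increasing_max(1)[OF assms]
    by (meson UNIV_I continuous_at_imp_continuous_at_within continuous_on_eq_continuous_at open_UNIV)
qed (rule continuous_increasing_max(2)[OF assms])

text \<open>The extended path is continuous and constant to the left of 0, so there is no atom at
  either endpoint.\<close>

lemma emeasure_path_measure:
  assumes "continuous_increasing P" "0 \<le> t"
  shows "emeasure (path_measure P) {0..t} = ennreal (P t - P 0)"
  unfolding path_measure_def
  using emeasure_interval_measure_Icc[OF assms(2) continuous_increasing_max(2)[OF assms(1)]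
      continuous_increasing_max(1)[OF assms(1)]] assms(2) by simp

lemma upto_time_measurable [measurable]: "upto_time \<tau> \<in> sets borel"
proof -
  have "upto_time \<tau> = {s \<in> space borel. 0 \<le> s \<and> ennreal s \<le> \<tau>}" by (simp add: upto_time_def)
  also have "\<dots> \<in> sets borel" by measurable
  finally show ?thesis .
qed

text \<open>Fubini applied to \<open>exp (- r * s) = (\<integral>u\<in>{s..}. r * exp (- r * u))\<close>. The right-hand side no longer
  mentions the path measure: it is additive in \<open>P\<close> and visibly measurable in a parameter.\<close>

lemma nn_integral_discount_path_measure:
  assumes r: "0 < r" and P: "continuous_increasing P"
  shows "(\<integral>\<^sup>+s\<in>upto_time \<tau>. ennreal (exp (- r * s)) \<partial>path_measure P)
    = (\<integral>\<^sup>+u\<in>{0..}. ennreal (r * exp (- r * u) * (P (enn2real (min (ennreal u) \<tau>)) - P 0)) \<partial>lborel)"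
proof -
  interpret P: sigma_finite_measure "path_measure P" by (rule sigma_finite_path_measure[OF P])
  interpret pair_sigma_finite lborel "path_measure P" ..
  \<comment> \<open>The antiderivative of \<open>r * exp (- r * u)\<close> is
    \<open>- exp (- r * u)\<close>, which vanishes at infinity because \<open>r\<close> is
    positive.\<close>
  have exp_eq: "ennreal (exp (- r * s)) = (\<integral>\<^sup>+u. ennreal (r * exp (- r * u)) * indicator {s..} u \<partial>lborel)"
    for s
  proof -
    have "((\<lambda>u. - exp (- r * u)) \<longlongrightarrow> - 0) at_top"
      using r by (intro tendsto_minus filterlim_compose[OF exp_at_bot]
          filterlim_tendsto_neg_mult_at_bot[OF tendsto_const] filterlim_ident) auto
    then have "(\<integral>\<^sup>+u. ennreal (r * exp (- r * u)) * indicator {s..} u \<partial>lborel) = ennreal (- 0 - - exp (- r * s))"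
      using r by (intro nn_integral_FTC_atLeast) (auto intro!: derivative_eq_intros)
    then show ?thesis by simp
  qed
  have "(\<integral>\<^sup>+s\<in>upto_time \<tau>. ennreal (exp (- r * s)) \<partial>path_measure P)
      = (\<integral>\<^sup>+s. (\<integral>\<^sup>+u. ennreal (r * exp (- r * u)) * indicator {..u} s * indicator (upto_time \<tau>) s \<partial>lborel)
          \<partial>path_measure P)"
    unfolding exp_eq
    by (intro nn_integral_cong, subst nn_integral_multc[symmetric])
      (auto intro!: nn_integral_cong simp: indicator_def)
  also have "\<dots> = (\<integral>\<^sup>+u. (\<integral>\<^sup>+s. ennreal (r * exp (- r * u)) * indicator {..u} s * indicator (upto_time \<tau>) s
          \<partial>path_measure P) \<partial>lborel)"
  proof (rule Fubini')
    have [measurable]: "(\<lambda>p. indicator {..fst p} (snd p) :: ennreal) \<in> borel_measurable (lborel \<Otimes>\<^sub>M path_measure P)"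
      unfolding indicator_def atMost_iff by measurable
    show "(\<lambda>(u, s). ennreal (r * exp (- r * u)) * indicator {..u} s * indicator (upto_time \<tau>) s)
        \<in> borel_measurable (lborel \<Otimes>\<^sub>M path_measure P)"
      unfolding split_beta' by measurable
  qed
  also have "\<dots> = (\<integral>\<^sup>+u\<in>{0..}. ennreal (r * exp (- r * u) * (P (enn2real (min (ennreal u) \<tau>)) - P 0)) \<partial>lborel)"
  proof (rule nn_integral_cong)
    fix u :: real
    let ?v = "enn2real (min (ennreal u) \<tau>)"
    show "(\<integral>\<^sup>+s. ennreal (r * exp (- r * u)) * indicator {..u} s * indicator (upto_time \<tau>) s \<partial>path_measure P)
      = ennreal (r * exp (- r * u) * (P ?v - P 0)) * indicator {0..} u"
    proof (cases "0 \<le> u")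
      case True
      \<comment> \<open>The minimum is at most \<open>ennreal u\<close>, hence finite even for
        infinite \<open>\<tau>\<close>, so \<open>enn2real\<close> loses nothing. The
        \<open>s\<close>-section at \<open>u\<close> is then the interval from 0 to
        \<open>?v\<close>.\<close>
      have v: "ennreal ?v = min (ennreal u) \<tau>"
        by (intro ennreal_enn2real) (auto simp: min_less_iff_disj)
      have "s \<le> u \<and> s \<in> upto_time \<tau> \<longleftrightarrow> s \<in> {0..?v}" for s
      proof (cases "0 \<le> s")
        case s: True
        have "s \<le> ?v \<longleftrightarrow> ennreal s \<le> ennreal ?v" by (simp add: ennreal_le_iff)
        also have "\<dots> \<longleftrightarrow> ennreal s \<le> min (ennreal u) \<tau>" by (simp only: v)
        also have "\<dots> \<longleftrightarrow> s \<le> u \<and> ennreal s \<le> \<tau>" using True by (simp add: ennreal_le_iff)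
        finally show ?thesis using s by (simp add: upto_time_def)
      qed (simp add: upto_time_def)
      then have "(\<integral>\<^sup>+s. ennreal (r * exp (- r * u)) * indicator {..u} s * indicator (upto_time \<tau>) s \<partial>path_measure P)
        = (\<integral>\<^sup>+s. ennreal (r * exp (- r * u)) * indicator {0..?v} s \<partial>path_measure P)"
        by (intro nn_integral_cong) (auto simp: indicator_def)
      also have "\<dots> = ennreal (r * exp (- r * u)) * ennreal (P ?v - P 0)"
        by (simp add: nn_integral_cmult_indicator emeasure_path_measure[OF P])
      finally show ?thesis using True r by (simp add: ennreal_mult'[symmetric])
    next
      case False
      \<comment> \<open>For negative \<open>u\<close> no \<open>s \<le> u\<close> lies in
        \<open>upto_time \<tau>\<close>, so both sides vanish.\<close>
      then have *: "ennreal (r * exp (- r * u)) * indicator {..u} s * indicator (upto_time \<tau>) s = 0" for s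
        by (auto simp: indicator_def upto_time_def)
      show ?thesis unfolding * using False by simp
    qed
  qed
  finally show ?thesis .
qed

text \<open>Here the measure itself depends on \<open>\<omega>\<close>. The Fubini formula replaces
  it by Lebesgue measure with a jointly measurable integrand.\<close>

lemma measurable_nn_integral_discount:
  fixes F :: "'a \<Rightarrow> real \<Rightarrow> real"
  assumes r: "0 < r"
    and F: "\<And>\<omega>. \<omega> \<in> space M \<Longrightarrow> continuous_increasing (F \<omega>)"
    and meas: "\<And>t. 0 \<le> t \<Longrightarrow> (\<lambda>\<omega>. F \<omega> t) \<in> borel_measurable M"
    and \<tau>[measurable]: "\<tau> \<in> borel_measurable M"
  shows "(\<lambda>\<omega>. \<integral>\<^sup>+s\<in>upto_time (\<tau> \<omega>). ennreal (exp (- r * s)) \<partial>path_measure (F \<omega>)) \<in> borel_measurable M"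
proof -
  \<comment> \<open>On the product space, the minimum of \<open>u\<close> and
    \<open>\<tau> \<omega>\<close> is the random time at which the path is evaluated.\<close>
  have [measurable]: "(\<lambda>p. F (fst p) (enn2real (min (ennreal (snd p)) (\<tau> (fst p)))))
      \<in> borel_measurable (M \<Otimes>\<^sub>M lborel)"
  proof (rule measurable_at_random_time[where f = "\<lambda>t p. F (fst p) t"])
    show "(\<lambda>p. F (fst p) t) \<in> borel_measurable (M \<Otimes>\<^sub>M lborel)" if "0 \<le> t" for t
      using measurable_compose[OF measurable_fst meas[OF that]] .
  qed (use F in \<open>auto simp: space_pair_measure continuous_increasing_def\<close>)
  have [measurable]: "(\<lambda>\<omega>. F \<omega> 0) \<in> borel_measurable M" by (rule meas) simp
  have "(\<lambda>\<omega>. \<integral>\<^sup>+u\<in>{0..}. ennreal (r * exp (- r * u) * (F \<omega> (enn2real (min (ennreal u) (\<tau> \<omega>))) - F \<omega> 0)) \<partial>lborel)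
      \<in> borel_measurable M"
    by (rule lborel.borel_measurable_nn_integral) (simp add: split_beta')
  then show ?thesis
    by (subst measurable_cong[OF nn_integral_discount_path_measure[OF r F]])
qed

lemma set_integrable_discount_path_measure:
  assumes "(\<integral>\<^sup>+s\<in>upto_time \<tau>. ennreal (exp (- r * s)) \<partial>path_measure P) < \<infinity>"
  shows "set_integrable (path_measure P) (upto_time \<tau>) (\<lambda>s. exp (- r * s))"
  unfolding set_integrable_def
proof (rule integrableI_nonneg)
  have "(\<integral>\<^sup>+s. ennreal (indicat_real (upto_time \<tau>) s *\<^sub>R exp (- r * s)) \<partial>path_measure P)
      = (\<integral>\<^sup>+s\<in>upto_time \<tau>. ennreal (exp (- r * s)) \<partial>path_measure P)"
    by (intro nn_integral_cong) (auto simp: indicator_def)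
  with assms show "(\<integral>\<^sup>+s. ennreal (indicat_real (upto_time \<tau>) s *\<^sub>R exp (- r * s)) \<partial>path_measure P) < \<infinity>"
    by simp
qed auto

text \<open>This holds for infinite mass too: the Bochner integral of a non-integrable function and
  \<open>enn2real \<infinity>\<close> are both 0.\<close>

lemma set_integral_discount_eq_nn_integral:
  "(LINT s:upto_time \<tau>|path_measure P. exp (- r * s))
    = enn2real (\<integral>\<^sup>+s\<in>upto_time \<tau>. ennreal (exp (- r * s)) \<partial>path_measure P)"
  unfolding set_lebesgue_integral_def
  by (subst integral_eq_nn_integral)
    (auto intro!: arg_cong[where f = enn2real] nn_integral_cong simp: indicator_def)

text \<open>The real-valued form of the Fubini formula. Its right-hand side is linear in
  \<open>P\<close>, and the integrability of \<open>g\<close> allows two such formulas to be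
  subtracted.\<close>

lemma set_integral_discount_path_measure:
  assumes r: "0 < r" and P: "continuous_increasing P"
    and int: "set_integrable (path_measure P) (upto_time \<tau>) (\<lambda>s. exp (- r * s))"
  defines "g \<equiv> \<lambda>u. r * exp (- r * u) * (P (enn2real (min (ennreal u) \<tau>)) - P 0)"
  shows "set_integrable lborel {0..} g"
    "(LINT s:upto_time \<tau>|path_measure P. exp (- r * s)) = (LINT u:{0..}|lborel. g u)"
proof -
  have "mono_on {0..} P" "continuous_on {0..} P" using P by (auto simp: continuous_increasing_def)
  then have g: "0 \<le> g u" for u
    using r by (auto simp: g_def intro!: mult_nonneg_nonneg elim!: mono_onD)
  \<comment> \<open>Continuity of \<open>P\<close> is only given for nonnegative times;
    \<open>max 0\<close> does not change the value and yields a globally continuous outer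
    function.\<close>
  have "(\<lambda>u. P (max 0 (enn2real (min (ennreal u) \<tau>)))) \<in> borel_measurable borel"
    by (rule measurable_compose[OF _ borel_measurable_continuous_onI[OF continuous_increasing_max(1)[OF P]]])
      measurable
  then have [measurable]: "g \<in> borel_measurable borel" by (simp add: g_def)
  have nn: "(\<integral>\<^sup>+u. ennreal (indicator {0..} u *\<^sub>R g u) \<partial>lborel)
      = (\<integral>\<^sup>+s\<in>upto_time \<tau>. ennreal (exp (- r * s)) \<partial>path_measure P)"
    unfolding nn_integral_discount_path_measure[OF r P]
    by (intro nn_integral_cong) (auto simp: indicator_def g_def)
  also have "\<dots> < \<infinity>"
  proof -
    have "(\<integral>\<^sup>+s\<in>upto_time \<tau>. ennreal (exp (- r * s)) \<partial>path_measure P)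
        = (\<integral>\<^sup>+s. ennreal (norm (indicat_real (upto_time \<tau>) s *\<^sub>R exp (- r * s))) \<partial>path_measure P)"
      by (intro nn_integral_cong) (auto simp: indicator_def)
    with int show ?thesis by (simp add: set_integrable_def integrable_iff_bounded)
  qed
  finally show "set_integrable lborel {0..} g"
    unfolding set_integrable_def using g by (intro integrableI_nonneg) auto
  show "(LINT s:upto_time \<tau>|path_measure P. exp (- r * s)) = (LINT u:{0..}|lborel. g u)"
    unfolding set_integral_discount_eq_nn_integral unfolding nn[symmetric] set_lebesgue_integral_def
    by (rule integral_eq_nn_integral[symmetric]) (use g in auto)
qed

text \<open>Evaluating \<open>THE\<close> requires uniqueness. By Fubini, the value from any
  decomposition is one Lebesgue integral in which only \<open>f\<close> and \<open>\<tau>\<close>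
  occur, so all decompositions agree.\<close>

lemma stieltjes_integral_discount:
  assumes r: "0 < r" and P: "continuous_increasing P" and N: "continuous_increasing N"
    and f: "\<And>t. 0 \<le> t \<Longrightarrow> f t = P t - N t"
    and int: "set_integrable (path_measure P) (upto_time \<tau>) (\<lambda>s. exp (- r * s))"
      "set_integrable (path_measure N) (upto_time \<tau>) (\<lambda>s. exp (- r * s))"
  shows "stieltjes_integral f (upto_time \<tau>) (\<lambda>s. exp (- r * s))
    = (LINT s:upto_time \<tau>|path_measure P. exp (- r * s))
      - (LINT s:upto_time \<tau>|path_measure N. exp (- r * s))"
proof -
  have eq: "(LINT s:upto_time \<tau>|path_measure P. exp (- r * s))
      - (LINT s:upto_time \<tau>|path_measure N. exp (- r * s))
      = (LINT u:{0..}|lborel. r * exp (- r * u) * (f (enn2real (min (ennreal u) \<tau>)) - f 0))"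
    if "continuous_increasing P" "continuous_increasing N" "\<And>t. 0 \<le> t \<Longrightarrow> f t = P t - N t"
      "set_integrable (path_measure P) (upto_time \<tau>) (\<lambda>s. exp (- r * s))"
      "set_integrable (path_measure N) (upto_time \<tau>) (\<lambda>s. exp (- r * s))" for P N
  proof -
    have "r * exp (- r * u) * (f (enn2real (min (ennreal u) \<tau>)) - f 0)
        = r * exp (- r * u) * (P (enn2real (min (ennreal u) \<tau>)) - P 0)
          - r * exp (- r * u) * (N (enn2real (min (ennreal u) \<tau>)) - N 0)" for u
      by (simp add: that(3) algebra_simps)
    then show ?thesis
      using set_integral_diff(2)[OF set_integral_discount_path_measure(1)[OF r that(1,4)]
          set_integral_discount_path_measure(1)[OF r that(2,5)]]
      by (simp only: set_integral_discount_path_measure(2)[OF r that(1,4)]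
          set_integral_discount_path_measure(2)[OF r that(2,5)])
  qed
  show ?thesis
    unfolding stieltjes_integral_def
  proof (rule the_equality)
    show "has_stieltjes_integral f (upto_time \<tau>) (\<lambda>s. exp (- r * s))
      ((LINT s:upto_time \<tau>|path_measure P. exp (- r * s)) - (LINT s:upto_time \<tau>|path_measure N. exp (- r * s)))"
      unfolding has_stieltjes_integral_def using P N f int by blast
    fix v assume "has_stieltjes_integral f (upto_time \<tau>) (\<lambda>s. exp (- r * s)) v"
    then obtain P' N' where
      "continuous_increasing P'" "continuous_increasing N'" "\<And>t. 0 \<le> t \<Longrightarrow> f t = P' t - N' t"
      "set_integrable (path_measure P') (upto_time \<tau>) (\<lambda>s. exp (- r * s))"
      "set_integrable (path_measure N') (upto_time \<tau>) (\<lambda>s. exp (- r * s))"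
      and v: "v = (LINT s:upto_time \<tau>|path_measure P'. exp (- r * s))
        - (LINT s:upto_time \<tau>|path_measure N'. exp (- r * s))"
      unfolding has_stieltjes_integral_def by blast
    from eq[OF this(1-5)] eq[OF P N f int]
    show "v = (LINT s:upto_time \<tau>|path_measure P. exp (- r * s))
        - (LINT s:upto_time \<tau>|path_measure N. exp (- r * s))"
      unfolding v by simp
  qed
qed

text \<open>Dominated convergence, with the integrand on \<open>upto_time \<tau>\<close> as
  majorant. Since \<open>ev\<close> includes \<open>s = \<tau>\<close>, the indicators are
  eventually constant at every point.\<close>

lemma set_integral_discount_tendsto:
  assumes int: "set_integrable (path_measure P) (upto_time \<tau>) (\<lambda>s. exp (- r * s))"
    and le: "\<And>k. \<theta> k \<le> \<tau>"
    and ev: "\<And>s. 0 \<le> s \<Longrightarrow> ennreal s \<le> \<tau> \<Longrightarrow> \<forall>\<^sub>F k in sequentially. ennreal s \<le> \<theta> k"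
  shows "(\<lambda>k. LINT s:upto_time (\<theta> k)|path_measure P. exp (- r * s))
    \<longlonglongrightarrow> (LINT s:upto_time \<tau>|path_measure P. exp (- r * s))"
  unfolding set_lebesgue_integral_def
proof (rule integral_dominated_convergence)
  show "integrable (path_measure P) (\<lambda>s. indicat_real (upto_time \<tau>) s *\<^sub>R exp (- r * s))"
    using int by (simp add: set_integrable_def)
  show "AE s in path_measure P. norm (indicat_real (upto_time (\<theta> k)) s *\<^sub>R exp (- r * s))
      \<le> indicat_real (upto_time \<tau>) s *\<^sub>R exp (- r * s)" for k
    using order_trans[OF _ le[of k]] by (auto simp: indicator_def upto_time_def)
  have "\<forall>\<^sub>F k in sequentially. indicat_real (upto_time (\<theta> k)) s = indicat_real (upto_time \<tau>) s" for s
  proof (cases "s \<in> upto_time \<tau>")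
    case True
    then have "\<forall>\<^sub>F k in sequentially. ennreal s \<le> \<theta> k" by (intro ev) (auto simp: upto_time_def)
    then show ?thesis by eventually_elim (use True in \<open>auto simp: upto_time_def\<close>)
  next
    case False
    then have "s \<notin> upto_time (\<theta> k)" for k
      using order_trans[OF _ le[of k]] by (auto simp: upto_time_def)
    with False show ?thesis by simp
  qed
  then show "AE s in path_measure P. (\<lambda>k. indicat_real (upto_time (\<theta> k)) s *\<^sub>R exp (- r * s))
      \<longlonglongrightarrow> indicat_real (upto_time \<tau>) s *\<^sub>R exp (- r * s)"
    by (intro AE_I2 tendsto_eventually) (auto elim: eventually_mono)
qed measurable

text \<open>Passes from \<open>hitting_time\<close> to the earlier times \<open>\<theta> k\<close>;
  the two inequalities yield the majorant for the final limit.\<close>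

lemma set_integral_discount_mono:
  assumes "set_integrable (path_measure P) (upto_time \<tau>) (\<lambda>s. exp (- r * s))" "\<theta> \<le> \<tau>"
  shows "set_integrable (path_measure P) (upto_time \<theta>) (\<lambda>s. exp (- r * s))"
    "0 \<le> (LINT s:upto_time \<theta>|path_measure P. exp (- r * s))"
    "(LINT s:upto_time \<theta>|path_measure P. exp (- r * s)) \<le> (LINT s:upto_time \<tau>|path_measure P. exp (- r * s))"
proof -
  have sub: "upto_time \<theta> \<subseteq> upto_time \<tau>" using assms(2) by (auto simp: upto_time_def)
  show int: "set_integrable (path_measure P) (upto_time \<theta>) (\<lambda>s. exp (- r * s))"
    by (rule set_integrable_subset[OF assms(1) _ sub]) simp
  show "0 \<le> (LINT s:upto_time \<theta>|path_measure P. exp (- r * s))"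
    unfolding set_lebesgue_integral_def by (intro Bochner_Integration.integral_nonneg) simp
  show "(LINT s:upto_time \<theta>|path_measure P. exp (- r * s)) \<le> (LINT s:upto_time \<tau>|path_measure P. exp (- r * s))"
    using int assms(1) sub unfolding set_lebesgue_integral_def set_integrable_def
    by (intro integral_mono) (auto simp: indicator_def)
qed

subsection \<open>The reflected diffusion\<close>

text \<open>Continuity within \<open>A\<close> is local, and \<open>cball y u \<inter> A\<close> is
  a neighbourhood of \<open>y\<close> relative to \<open>A\<close>.\<close>

lemma continuous_on_locally_lipschitz:
  assumes "\<And>y. y \<in> A \<Longrightarrow> \<exists>u>0. \<exists>C. C-lipschitz_on (cball y u \<inter> A) f"
  shows "continuous_on A f"
  unfolding continuous_on_eq_continuous_within
proof
  fix y assume y: "y \<in> A"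
  then obtain u C where u: "u > 0" "C-lipschitz_on (cball y u \<inter> A) f" using assms by blast
  have "continuous_on (cball y u \<inter> A) f" by (rule lipschitz_on_continuous_on[OF u(2)])
  then have "continuous (at y within (cball y u \<inter> A)) f"
    using y u(1) by (auto simp: continuous_on_eq_continuous_within)
  moreover have "at y within (cball y u \<inter> A) = at y within A"
    by (rule at_within_nhd[of y "ball y u"]) (use u(1) in auto)
  ultimately show "continuous (at y within A) f" by simp
qed

locale standing_setting =
  fixes S :: "'w model" and x :: "real^2"
  assumes standing: "standing_assumptions S" and x: "x \<in> quadrant"
begin

lemma usual: "usual_conditions S"
  using standing by (simp add: standing_assumptions_def)

sublocale prob_space "Prob S"
  using usual by (simp add: usual_conditions_def)

lemma rate_pos: "0 < rate S" and slope_pos: "0 < slope S"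
  using standing by (auto simp: standing_assumptions_def)

lemma filtration_sub: "space (Filt S t) = space (Prob S)" "sets (Filt S t) \<subseteq> sets (Prob S)"
proof -
  interpret filtration "space (Prob S)" "Filt S"
    using usual by (simp add: usual_conditions_def)
  show "space (Filt S t) = space (Prob S)" by (rule space_F)
  show "sets (Filt S t) \<subseteq> sets (Prob S)" using usual by (simp add: usual_conditions_def)
qed

lemma measurable_adapted:
  assumes "adapted S Z" "0 \<le> t"
  shows "Z t \<in> borel_measurable (Prob S)"
proof -
  have "subalgebra (Prob S) (Filt S (ennreal t))" by (simp add: subalgebra_def filtration_sub)
  moreover have "Z t \<in> borel_measurable (Filt S (ennreal t))" using assms by (simp add: adapted_def)
  ultimately show ?thesis by (rule measurable_from_subalg)
qed

lemma flow_solution: "reflected_solution S x (flow S x) (push S x)"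
  using standing x by (simp add: standing_assumptions_def unique_strong_solution_def)

lemma flow_measurable: "0 \<le> t \<Longrightarrow> flow S x t \<in> borel_measurable (Prob S)"
  using flow_solution by (intro measurable_adapted) (auto simp: reflected_solution_def)

lemma flow_continuous: "\<omega> \<in> space (Prob S) \<Longrightarrow> continuous_on {0..} (\<lambda>t. flow S x t \<omega>)"
  using flow_solution by (simp add: reflected_solution_def continuous_paths_def)

lemma flow_quadrant: "\<omega> \<in> space (Prob S) \<Longrightarrow> 0 \<le> t \<Longrightarrow> flow S x t \<omega> \<in> quadrant"
  using flow_solution by (simp add: reflected_solution_def)

lemma local_time:
  "0 \<le> t \<Longrightarrow> loctime S x t \<in> borel_measurable (Prob S)"
  "\<omega> \<in> space (Prob S) \<Longrightarrow> continuous_increasing (\<lambda>t. loctime S x t \<omega>)"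
proof -
  have l: "is_local_time S x (loctime S x)"
    using standing x by (simp add: standing_assumptions_def)
  then show "0 \<le> t \<Longrightarrow> loctime S x t \<in> borel_measurable (Prob S)"
    by (intro measurable_adapted) (auto simp: is_local_time_def)
  show "\<omega> \<in> space (Prob S) \<Longrightarrow> continuous_increasing (\<lambda>t. loctime S x t \<omega>)"
    using l by (simp add: is_local_time_def)
qed

section \<open>Measurability and local integrability along the flow\<close>

lemma drift_continuous: "continuous_on quadrant (drift S)"
proof (rule continuous_on_locally_lipschitz)
  fix y :: "real^2" assume "y \<in> quadrant"
  then show "\<exists>u>0. \<exists>C. C-lipschitz_on (cball y u \<inter> quadrant) (drift S)"
    using standing unfolding standing_assumptions_def coefficient_regularity_def by blast
qed

lemma cost_continuous: "continuous_on quadrant (cost S)"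
  using standing by (simp add: standing_assumptions_def)

lemma cost_measurable [measurable]: "cost S \<in> borel_measurable (restrict_space borel quadrant)"
  by (rule borel_measurable_continuous_on_restrict[OF cost_continuous])

text \<open>The function is continuous on each piece cut out by the contact line. The coefficients
  are regular on the quadrant only, hence the restricted sigma-algebra.\<close>

lemma gamma_ac_measurable [measurable]:
  "gamma_ac S \<in> borel_measurable (restrict_space borel quadrant)"
proof -
  have [measurable]: "drift S \<in> borel_measurable (restrict_space borel quadrant)"
    by (rule borel_measurable_continuous_on_restrict[OF drift_continuous])
  have [measurable]: "(\<lambda>y. y $ i) \<in> borel_measurable (restrict_space borel (quadrant :: (real^2) set))"
    "(\<lambda>y. drift S y $ i) \<in> borel_measurable (restrict_space borel quadrant)" for i
    by (rule measurable_restrict_space1[OF borel_measurable_nth],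
        rule measurable_compose[OF _ borel_measurable_nth], measurable)
  show ?thesis unfolding gamma_ac_def[abs_def] by measurable
qed

text \<open>The flow is unconstrained at negative times; \<open>max 0\<close> avoids them and keeps
  the values in the quadrant.\<close>

lemma flow_joint_measurable:
  "(\<lambda>p. flow S x (max 0 (snd p)) (fst p)) \<in> Prob S \<Otimes>\<^sub>M lborel \<rightarrow>\<^sub>M restrict_space borel quadrant"
proof (rule measurable_restrict_space2)
  show "(\<lambda>p. flow S x (max 0 (snd p)) (fst p)) \<in> borel_measurable (Prob S \<Otimes>\<^sub>M lborel)"
    by (rule measurable_at_random_time[where f = "\<lambda>t p. flow S x t (fst p)"])
      (auto simp: space_pair_measure intro: flow_continuous measurable_compose[OF measurable_fst flow_measurable])
qed (auto simp: space_pair_measure intro!: flow_quadrant)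

text \<open>\<open>gamma_ac\<close> may jump across the contact line, so integrability comes from
  measurability and the continuous majorant \<open>b\<close>, the sum of the absolute values of all
  terms in both branches.\<close>

lemma gamma_ac_set_integrable:
  assumes \<omega>: "\<omega> \<in> space (Prob S)" and T: "0 \<le> T"
  shows "set_integrable lborel {0..T} (\<lambda>s. gamma_ac S (flow S x s \<omega>))"
proof -
  define b where "b y = \<bar>cost S y\<bar> + rate S * \<bar>y $ 1\<bar> + \<bar>drift S y $ 1\<bar>
    + rate S * slope S * \<bar>y $ 2\<bar> + slope S * \<bar>drift S y $ 2\<bar>" for y
  have "continuous_on quadrant b"
    unfolding b_def by (intro continuous_intros drift_continuous cost_continuous)
  then have "continuous_on {0..T} (\<lambda>s. b (flow S x s \<omega>))"
    by (rule continuous_on_compose2[OF _ continuous_on_subset[OF flow_continuous[OF \<omega>]]])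
      (auto intro: flow_quadrant[OF \<omega>])
  then have b: "set_integrable lborel {0..T} (\<lambda>s. b (flow S x s \<omega>))"
    unfolding set_integrable_def by (intro borel_integrable_compact) auto
  have le: "\<bar>gamma_ac S y\<bar> \<le> b y" for y
    using rate_pos slope_pos
    by (auto simp: gamma_ac_def b_def abs_mult intro!: order_trans[OF abs_triangle_ineq4] order_trans[OF abs_triangle_ineq])
  have "(\<lambda>s. flow S x s \<omega>) \<in> restrict_space borel {0..T} \<rightarrow>\<^sub>M restrict_space borel quadrant"
    by (intro measurable_restrict_space2 borel_measurable_continuous_on_restrict
        continuous_on_subset[OF flow_continuous[OF \<omega>]])
      (auto simp: space_restrict_space intro: flow_quadrant[OF \<omega>])
  from measurable_compose[OF this gamma_ac_measurable]
  have "(\<lambda>s. indicator {0..T} s *\<^sub>R gamma_ac S (flow S x s \<omega>)) \<in> borel_measurable lborel"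
    by (subst (asm) borel_measurable_restrict_space_iff) auto
  then show ?thesis
    using b unfolding set_integrable_def
    by (elim Bochner_Integration.integrable_bound[rotated])
      (auto simp: indicator_def intro!: AE_I2 order_trans[OF le])
qed

lemma time_integral_measurable:
  fixes f :: "real^2 \<Rightarrow> real"
  assumes [measurable]: "f \<in> borel_measurable (restrict_space borel quadrant)"
  shows "(\<lambda>\<omega>. LINT s:{0..t}|lborel. f (flow S x s \<omega>)) \<in> borel_measurable (Prob S)"
proof -
  note flow_joint_measurable[measurable]
  have "(\<lambda>\<omega>. LINT s|lborel. indicator {0..t} s *\<^sub>R f (flow S x (max 0 s) \<omega>)) \<in> borel_measurable (Prob S)"
    by (rule lborel.borel_measurable_lebesgue_integral) (simp add: split_beta')
  also have "(\<lambda>\<omega>. LINT s|lborel. indicator {0..t} s *\<^sub>R f (flow S x (max 0 s) \<omega>))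
      = (\<lambda>\<omega>. LINT s:{0..t}|lborel. f (flow S x s \<omega>))"
    unfolding set_lebesgue_integral_def
    by (intro ext Bochner_Integration.integral_cong) (auto simp: indicator_def max_def)
  finally show ?thesis .
qed

lemma gamma_parts_integrable:
  assumes "\<omega> \<in> space (Prob S)" "0 \<le> T"
  shows "set_integrable lborel {0..T} (\<lambda>s. max 0 (gamma_ac S (flow S x s \<omega>)))"
    "set_integrable lborel {0..T} (\<lambda>s. max 0 (- gamma_ac S (flow S x s \<omega>)))"
proof -
  have *: "set_integrable lborel {0..T} (\<lambda>s. max 0 (g s))" if "set_integrable lborel {0..T} g"
    for g :: "real \<Rightarrow> real"
  proof -
    have "integrable lborel (\<lambda>s. max 0 (indicat_real {0..T} s *\<^sub>R g s))"
      using that by (simp add: set_integrable_def)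
    also have "(\<lambda>s. max 0 (indicat_real {0..T} s *\<^sub>R g s)) = (\<lambda>s. indicat_real {0..T} s *\<^sub>R max 0 (g s))"
      by (auto simp: indicator_def)
    finally show ?thesis by (simp add: set_integrable_def)
  qed
  show "set_integrable lborel {0..T} (\<lambda>s. max 0 (gamma_ac S (flow S x s \<omega>)))"
    "set_integrable lborel {0..T} (\<lambda>s. max 0 (- gamma_ac S (flow S x s \<omega>)))"
    using *[OF gamma_ac_set_integrable[OF assms]]
      *[of "\<lambda>s. - gamma_ac S (flow S x s \<omega>)"] gamma_ac_set_integrable[OF assms]
    by (simp_all add: set_integrable_def)
qed

section \<open>The additive functionals of \<open>\<Gamma>\<close> and the payoff\<close>

lemma A_gamma_pos:
  "\<omega> \<in> space (Prob S) \<Longrightarrow> continuous_increasing (\<lambda>t. A_gamma_pos S x t \<omega>)"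
  "A_gamma_pos S x t \<in> borel_measurable (Prob S)"
proof -
  show "continuous_increasing (\<lambda>t. A_gamma_pos S x t \<omega>)" if \<omega>: "\<omega> \<in> space (Prob S)"
    unfolding A_gamma_pos_def
    by (intro continuous_increasing_indefinite_integral gamma_parts_integrable \<omega> max.cobounded1)
  show "A_gamma_pos S x t \<in> borel_measurable (Prob S)"
    unfolding A_gamma_pos_def[abs_def] by (rule time_integral_measurable) measurable
qed

lemma A_gamma_neg:
  "\<omega> \<in> space (Prob S) \<Longrightarrow> continuous_increasing (\<lambda>t. A_gamma_neg S x t \<omega>)"
  "0 \<le> t \<Longrightarrow> A_gamma_neg S x t \<in> borel_measurable (Prob S)"
proof -
  assume \<omega>: "\<omega> \<in> space (Prob S)"
  have "continuous_increasing (\<lambda>t. LINT s:{0..t}|lborel. max 0 (- gamma_ac S (flow S x s \<omega>)))"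
    by (intro continuous_increasing_indefinite_integral gamma_parts_integrable \<omega> max.cobounded1)
  with local_time(2)[OF \<omega>] show "continuous_increasing (\<lambda>t. A_gamma_neg S x t \<omega>)"
    unfolding A_gamma_neg_def continuous_increasing_def
    by (intro conjI continuous_intros mono_onI add_mono mult_left_mono) (simp_all add: mono_on_def)
next
  assume t: "0 \<le> t"
  note local_time(1)[OF t, measurable]
  have [measurable]: "(\<lambda>\<omega>. LINT s:{0..t}|lborel. max 0 (- gamma_ac S (flow S x s \<omega>))) \<in> borel_measurable (Prob S)"
    by (rule time_integral_measurable) measurable
  show "A_gamma_neg S x t \<in> borel_measurable (Prob S)"
    unfolding A_gamma_neg_def[abs_def] by measurable
qed

text \<open>Local time enters with a negative sign and is carried by \<open>A_gamma_neg\<close>, so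
  this is a difference of non-decreasing paths, as \<open>stieltjes_integral_discount\<close>
  requires.\<close>

lemma A_gamma_decomposition:
  assumes "\<omega> \<in> space (Prob S)" "0 \<le> t"
  shows "A_gamma S x t \<omega> = A_gamma_pos S x t \<omega> - A_gamma_neg S x t \<omega>"
proof -
  have "(LINT s:{0..t}|lborel. gamma_ac S (flow S x s \<omega>))
      = (LINT s:{0..t}|lborel. max 0 (gamma_ac S (flow S x s \<omega>)) - max 0 (- gamma_ac S (flow S x s \<omega>)))"
    by (intro set_lebesgue_integral_cong) auto
  also have "\<dots> = (LINT s:{0..t}|lborel. max 0 (gamma_ac S (flow S x s \<omega>)))
      - (LINT s:{0..t}|lborel. max 0 (- gamma_ac S (flow S x s \<omega>)))"
    by (intro set_integral_diff gamma_parts_integrable assms)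
  finally show ?thesis by (simp add: A_gamma_def A_gamma_pos_def A_gamma_neg_def)
qed

text \<open>The running cost is measurable by joint measurability of the flow and of the indicator
  of \<open>upto_time (\<tau> \<omega>)\<close>; for the reward this is contained in the
  integrability demanded of admissible times.\<close>

lemma payoff_measurable:
  assumes "\<tau> \<in> admissible_times S x"
  shows "\<tau> \<in> borel_measurable (Prob S)" "payoff S x \<tau> \<in> borel_measurable (Prob S)"
proof -
  have "stopping_time (Filt S) \<tau>" using assms by (simp add: admissible_times_def)
  then show [measurable]: "\<tau> \<in> borel_measurable (Prob S)"
    by (rule measurable_stopping_time) (auto simp: filtration_sub dest: subsetD[OF filtration_sub(2)])
  note flow_joint_measurable[measurable]
  have [measurable]: "(\<lambda>p. indicat_real (upto_time (\<tau> (fst p))) (snd p)) \<in> borel_measurable (Prob S \<Otimes>\<^sub>M lborel)"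
    unfolding indicator_def upto_time_def mem_Collect_eq by measurable
  have "(\<lambda>\<omega>. LINT s|lborel. indicat_real (upto_time (\<tau> \<omega>)) s
      *\<^sub>R (exp (- rate S * s) * cost S (flow S x (max 0 s) \<omega>))) \<in> borel_measurable (Prob S)"
    by (rule lborel.borel_measurable_lebesgue_integral) (simp add: split_beta')
  also have "(\<lambda>\<omega>. LINT s|lborel. indicat_real (upto_time (\<tau> \<omega>)) s
      *\<^sub>R (exp (- rate S * s) * cost S (flow S x (max 0 s) \<omega>))) = running_cost S x \<tau>"
    unfolding running_cost_def[abs_def] set_lebesgue_integral_def
    by (intro ext Bochner_Integration.integral_cong) (auto simp: indicator_def upto_time_def max_def)
  finally have "running_cost S x \<tau> \<in> borel_measurable (Prob S)" .
  moreover have "reward S x \<tau> \<in> borel_measurable (Prob S)"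
    using assms by (auto simp: admissible_times_def)
  ultimately show "payoff S x \<tau> \<in> borel_measurable (Prob S)"
    unfolding payoff_def[abs_def] by measurable
qed

end

section \<open>Completeness, killed potentials and the limit along \<open>\<theta> k\<close>\<close>

sublocale standing_setting \<subseteq> complete_measure "Prob S"
proof
  fix A B assume "B \<subseteq> A" "A \<in> null_sets (Prob S)"
  \<comment> \<open>The usual conditions put all subsets of null sets into \<open>Filt S 0\<close>,
    which is contained in the full sigma-algebra.\<close>
  with usual have "B \<in> sets (Filt S 0)" unfolding usual_conditions_def by blast
  then show "B \<in> sets (Prob S)" using filtration_sub(2) by blast
qed

text \<open>A finite expectation forces the pathwise mass to be finite almost surely, so the
  pathwise integral is meaningful, and bounds its mean. The functional is generic in order to cover
  both parts of \<open>\<Gamma>\<close>.\<close>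

lemma (in standing_setting) killed_potential_integrable:
  assumes A: "\<And>\<omega>. \<omega> \<in> space (Prob S) \<Longrightarrow> continuous_increasing (\<lambda>t. A x t \<omega>)"
    "\<And>t. 0 \<le> t \<Longrightarrow> A x t \<in> borel_measurable (Prob S)"
    and fin: "killed_resolvent_nn S A x < \<infinity>"
    and \<tau>: "hitting_time S x \<in> borel_measurable (Prob S)"
  shows "AE \<omega> in Prob S. set_integrable (path_measure (\<lambda>t. A x t \<omega>)) (upto_time (hitting_time S x \<omega>))
      (\<lambda>s. exp (- rate S * s))"
    "integrable (Prob S) (\<lambda>\<omega>. LINT s:upto_time (hitting_time S x \<omega>)|path_measure (\<lambda>t. A x t \<omega>).
      exp (- rate S * s))"
proof -
  let ?n = "\<lambda>\<omega>. \<integral>\<^sup>+s\<in>upto_time (hitting_time S x \<omega>). ennreal (exp (- rate S * s)) \<partial>path_measure (\<lambda>t. A x t \<omega>)"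
  have meas[measurable]: "?n \<in> borel_measurable (Prob S)"
    by (rule measurable_nn_integral_discount[OF rate_pos A \<tau>])
  have fin: "(\<integral>\<^sup>+\<omega>. ?n \<omega> \<partial>Prob S) < \<infinity>" using fin by (simp add: killed_resolvent_nn_def)
  then have AE: "AE \<omega> in Prob S. ?n \<omega> < \<infinity>"
    using nn_integral_PInf_AE[OF meas] by (auto simp: less_top)
  then show "AE \<omega> in Prob S. set_integrable (path_measure (\<lambda>t. A x t \<omega>)) (upto_time (hitting_time S x \<omega>))
      (\<lambda>s. exp (- rate S * s))"
    by eventually_elim (rule set_integrable_discount_path_measure)
  \<comment> \<open>\<open>enn2real\<close> changes the value only on the null set where the mass is
    infinite.\<close>
  have "(\<integral>\<^sup>+\<omega>. ennreal (enn2real (?n \<omega>)) \<partial>Prob S) = (\<integral>\<^sup>+\<omega>. ?n \<omega> \<partial>Prob S)"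
    using AE by (intro nn_integral_cong_AE) (auto elim!: eventually_mono)
  with fin have "(\<integral>\<^sup>+\<omega>. ennreal (enn2real (?n \<omega>)) \<partial>Prob S) < \<infinity>" by simp
  moreover have "(\<lambda>\<omega>. enn2real (?n \<omega>)) \<in> borel_measurable (Prob S)" by measurable
  ultimately show "integrable (Prob S) (\<lambda>\<omega>. LINT s:upto_time (hitting_time S x \<omega>)|path_measure (\<lambda>t. A x t \<omega>).
      exp (- rate S * s))"
    unfolding set_integral_discount_eq_nn_integral by (intro integrableI_nonneg AE_I2 enn2real_nonneg)
qed

theorem theorem5p2:
  fixes S :: "'w model" and x :: "real^2"
    and N :: "real \<Rightarrow> 'w \<Rightarrow> real" and \<sigma> \<theta> :: "nat \<Rightarrow> 'w \<Rightarrow> ennreal"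
  assumes standing: "standing_assumptions S"
    and x: "x \<in> quadrant"
    and admissible: "admissible_potential S x"
    and optimal: "hitting_time_optimal S x"
    and local_mart: "local_martingale S N"
    and ito_tanaka: "AE \<omega> in Prob S. \<forall>t\<ge>0. ennreal t \<le> hitting_time S x \<omega> \<longrightarrow>
        exp (- rate S * t) * gain S (flow S x t \<omega>)
          = gain S x + (LINT s:{0..t}|lborel. exp (- rate S * s) * cost S (flow S x s \<omega>))
            - discounted_integral S (A_gamma S) x (ennreal t) \<omega> + N t \<omega>"
    and sigma_stopping: "\<And>k. stopping_time (Filt S) (\<sigma> k)"
    and sigma_infinity: "tends_to_infinity S \<sigma>"
    and theta: "\<And>k \<omega>. \<theta> k \<omega> = min (of_nat k) (min (\<sigma> k \<omega>) (hitting_time S x \<omega>))"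
    and mart_integrable: "\<And>k. integrable (Prob S) (\<lambda>\<omega>. N (enn2real (\<theta> k \<omega>)) \<omega>)"
    and mart_mean_zero: "\<And>k. (LINT \<omega>|Prob S. N (enn2real (\<theta> k \<omega>)) \<omega>) = 0"
    and unif_int: "uniformly_integrable (Prob S) (\<lambda>k. payoff S x (\<theta> k))"
    and as_conv: "AE \<omega> in Prob S.
        (\<lambda>k. payoff S x (\<theta> k) \<omega>) \<longlonglongrightarrow> payoff S x (hitting_time S x) \<omega>"
  shows "value_fun S x = gain S x - killed_resolvent S (A_gamma S) x \<and>
    value_fun S x = gain S x -
      (LINT \<omega>|Prob S. stieltjes_integral (\<lambda>t. A_gamma S x t \<omega>)
         {s. 0 \<le> s \<and> ennreal s \<le> hitting_time S x \<omega>} (\<lambda>s. exp (- rate S * s)))"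
proof -
  interpret standing_setting S x by standard fact+
  let ?T = "hitting_time S x"
  let ?e = "\<lambda>s. exp (- rate S * s)"
  let ?D = "\<lambda>\<omega> \<tau>. discounted_integral S (A_gamma S) x \<tau> \<omega>"
  let ?I = "\<lambda>A \<omega> \<tau>. LINT s:upto_time \<tau>|path_measure (\<lambda>t. A S x t \<omega>). ?e s"
  let ?ok = "\<lambda>A \<omega>. set_integrable (path_measure (\<lambda>t. A S x t \<omega>)) (upto_time (?T \<omega>)) ?e"
  have T_adm: "?T \<in> admissible_times S x" and V: "value_fun S x = (LINT \<omega>|Prob S. payoff S x ?T \<omega>)"
    using optimal by (auto simp: hitting_time_optimal_def)
  note T_meas = payoff_measurable[OF T_adm]
  have fin: "killed_resolvent_nn S (A_gamma_pos S) x < \<infinity>" "killed_resolvent_nn S (A_gamma_neg S) x < \<infinity>"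
    using admissible by (auto simp: admissible_potential_def ennreal_add_less_top)
  have pos: "AE \<omega> in Prob S. ?ok A_gamma_pos \<omega>" "integrable (Prob S) (\<lambda>\<omega>. ?I A_gamma_pos \<omega> (?T \<omega>))"
    by (rule killed_potential_integrable[OF A_gamma_pos fin(1) T_meas(1)]; assumption)+
  have neg: "AE \<omega> in Prob S. ?ok A_gamma_neg \<omega>" "integrable (Prob S) (\<lambda>\<omega>. ?I A_gamma_neg \<omega> (?T \<omega>))"
    by (rule killed_potential_integrable[OF A_gamma_neg fin(2) T_meas(1)]; assumption)+
  have D: "?D \<omega> \<tau> = ?I A_gamma_pos \<omega> \<tau> - ?I A_gamma_neg \<omega> \<tau>"
    if "\<omega> \<in> space (Prob S)" "\<tau> \<le> ?T \<omega>" "?ok A_gamma_pos \<omega>" "?ok A_gamma_neg \<omega>" for \<omega> \<tau>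
    unfolding discounted_integral_def
    by (rule stieltjes_integral_discount[OF rate_pos A_gamma_pos(1)[OF that(1)] A_gamma_neg(1)[OF that(1)]
          A_gamma_decomposition[OF that(1)] set_integral_discount_mono(1)[OF that(3,2)]
          set_integral_discount_mono(1)[OF that(4,2)]])
  have \<theta>_le: "\<theta> k \<omega> \<le> ?T \<omega>" for k \<omega> by (simp add: theta min_le_iff_disj)
  \<comment> \<open>The cap by \<open>k\<close> keeps \<open>\<theta> k\<close> finite even where
    \<open>\<D>\<close> is never hit, so \<open>reward\<close> is in its finite branch and
    \<open>enn2real\<close> is exact.\<close>
  have \<theta>_finite: "\<theta> k \<omega> < \<infinity>" for k \<omega>
    by (simp add: theta min_less_iff_disj of_nat_less_top)
  \<comment> \<open>This is the discounted integral up to \<open>\<theta> k\<close>, solved for in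
    the Ito-Tanaka identity. In this form its integrability and mean can be read off from those of
    \<open>N\<close> and the payoff.\<close>
  define Z where "Z k \<omega> = gain S x + N (enn2real (\<theta> k \<omega>)) \<omega> - payoff S x (\<theta> k) \<omega>" for k \<omega>
  have payoff_int: "integrable (Prob S) (payoff S x (\<theta> k))" for k
    using unif_int by (simp add: uniformly_integrable_def)
  have Z_int: "integrable (Prob S) (Z k)" for k
    unfolding Z_def by (intro Bochner_Integration.integrable_add Bochner_Integration.integrable_diff
        mart_integrable payoff_int integrable_const)
  have Z_mean: "(LINT \<omega>|Prob S. Z k \<omega>) = gain S x - (LINT \<omega>|Prob S. payoff S x (\<theta> k) \<omega>)" for k
    unfolding Z_def using mart_integrable payoff_int by (simp add: mart_mean_zero prob_space)
  \<comment> \<open>The identity holds for all times off one null set, so the same null set serves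
    every \<open>k\<close>.\<close>
  have Z_eq: "AE \<omega> in Prob S. \<forall>k. Z k \<omega> = ?D \<omega> (\<theta> k \<omega>)"
    using ito_tanaka
  proof eventually_elim
    case (elim \<omega>)
    show ?case
    proof
      fix k
      let ?t = "enn2real (\<theta> k \<omega>)"
      have t: "ennreal ?t = \<theta> k \<omega>" using \<theta>_finite by (simp add: less_top)
      have "upto_time (ennreal ?t) = {0..?t}" by (auto simp: upto_time_def ennreal_le_iff)
      then have "upto_time (\<theta> k \<omega>) = {0..?t}" by (simp only: t)
      then have "payoff S x (\<theta> k) \<omega> = ?e ?t * gain S (flow S x ?t \<omega>)
          - (LINT s:{0..?t}|lborel. ?e s * cost S (flow S x s \<omega>))"
        using \<theta>_finite[of k \<omega>] by (simp add: payoff_def reward_def running_cost_def)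
      with elim[rule_format, of ?t] \<theta>_le[of k \<omega>] show "Z k \<omega> = ?D \<omega> (\<theta> k \<omega>)"
        by (simp add: Z_def t)
    qed
  qed
  \<comment> \<open>Both \<open>k\<close> and \<open>\<sigma> k\<close> eventually exceed
    \<open>s\<close>, and the third term of the minimum is the hitting time itself, so the endpoint
    is reached when it is finite.\<close>
  have reach: "\<forall>\<^sub>F k in sequentially. ennreal s \<le> \<theta> k \<omega>"
    if "(\<lambda>k. \<sigma> k \<omega>) \<longlonglongrightarrow> \<infinity>" "ennreal s \<le> ?T \<omega>" for s \<omega>
  proof -
    have "\<forall>\<^sub>F k in sequentially. ennreal s < \<sigma> k \<omega>"
      using order_tendstoD(1)[OF that(1), of "ennreal s"] by simp
    moreover have "\<forall>\<^sub>F k in sequentially. s \<le> real k"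
      using filterlim_real_sequentially by (simp add: filterlim_at_top)
    ultimately show ?thesis
    proof eventually_elim
      case (elim k)
      from ennreal_leI[OF elim(2)] elim(1) that(2) show ?case
        by (simp add: theta ennreal_of_nat_eq_real_of_nat)
    qed
  qed
  have "(\<lambda>k. LINT \<omega>|Prob S. Z k \<omega>) \<longlonglongrightarrow>
      (LINT \<omega>|Prob S. ?I A_gamma_pos \<omega> (?T \<omega>) - ?I A_gamma_neg \<omega> (?T \<omega>))"
  proof (rule integral_dominated_convergence)
    show "integrable (Prob S) (\<lambda>\<omega>. ?I A_gamma_pos \<omega> (?T \<omega>) + ?I A_gamma_neg \<omega> (?T \<omega>))"
      "(\<lambda>\<omega>. ?I A_gamma_pos \<omega> (?T \<omega>) - ?I A_gamma_neg \<omega> (?T \<omega>)) \<in> borel_measurable (Prob S)"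
      using pos(2) neg(2) by auto
    show "Z k \<in> borel_measurable (Prob S)" for k using Z_int by auto
    show "AE \<omega> in Prob S. norm (Z k \<omega>) \<le> ?I A_gamma_pos \<omega> (?T \<omega>) + ?I A_gamma_neg \<omega> (?T \<omega>)" for k
      using Z_eq pos(1) neg(1) AE_space
    proof eventually_elim
      case (elim \<omega>)
      show ?case
        using set_integral_discount_mono(2,3)[OF elim(2) \<theta>_le[of k]]
          set_integral_discount_mono(2,3)[OF elim(3) \<theta>_le[of k]] elim(1) D[OF elim(4) \<theta>_le[of k] elim(2,3)]
        by simp
    qed
    show "AE \<omega> in Prob S. (\<lambda>k. Z k \<omega>) \<longlonglongrightarrow> ?I A_gamma_pos \<omega> (?T \<omega>) - ?I A_gamma_neg \<omega> (?T \<omega>)"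
      using Z_eq pos(1) neg(1) AE_space sigma_infinity[unfolded tends_to_infinity_def]
    proof eventually_elim
      case (elim \<omega>)
      have "(\<lambda>k. ?I A_gamma_pos \<omega> (\<theta> k \<omega>) - ?I A_gamma_neg \<omega> (\<theta> k \<omega>))
          \<longlonglongrightarrow> ?I A_gamma_pos \<omega> (?T \<omega>) - ?I A_gamma_neg \<omega> (?T \<omega>)"
        using elim by (intro tendsto_diff set_integral_discount_tendsto \<theta>_le reach) auto
      with elim(1) show ?case using D[OF elim(4) \<theta>_le elim(2,3)] by simp
    qed
  qed
  also have "(LINT \<omega>|Prob S. ?I A_gamma_pos \<omega> (?T \<omega>) - ?I A_gamma_neg \<omega> (?T \<omega>))
      = (LINT \<omega>|Prob S. ?D \<omega> (?T \<omega>))"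
  proof (rule integral_cong_AE)
    show eq: "AE \<omega> in Prob S. ?I A_gamma_pos \<omega> (?T \<omega>) - ?I A_gamma_neg \<omega> (?T \<omega>) = ?D \<omega> (?T \<omega>)"
      using pos(1) neg(1) AE_space by eventually_elim (simp add: D)
    show meas: "(\<lambda>\<omega>. ?I A_gamma_pos \<omega> (?T \<omega>) - ?I A_gamma_neg \<omega> (?T \<omega>)) \<in> borel_measurable (Prob S)"
      using pos(2) neg(2) by auto
    \<comment> \<open>The integral defined by \<open>THE\<close> is identified only almost surely,
      so its measurability rests on completeness.\<close>
    show "(\<lambda>\<omega>. ?D \<omega> (?T \<omega>)) \<in> borel_measurable (Prob S)"
      by (rule measurable_if_AE_eq[OF meas eq]) simp
  qed
  finally have "(\<lambda>k. gain S x - (LINT \<omega>|Prob S. payoff S x (\<theta> k) \<omega>))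
      \<longlonglongrightarrow> killed_resolvent S (A_gamma S) x"
    by (simp only: Z_mean killed_resolvent_def)
  \<comment> \<open>Vitali's theorem turns the assumed almost sure convergence of the payoffs into
    convergence of means, and optimality identifies the limit as the value.\<close>
  moreover have "(\<lambda>k. gain S x - (LINT \<omega>|Prob S. payoff S x (\<theta> k) \<omega>)) \<longlonglongrightarrow> gain S x - value_fun S x"
    unfolding V
    by (intro tendsto_diff tendsto_const uniformly_integrable_tendsto_integral(2)[OF _ unif_int T_meas(2) as_conv])
      unfold_locales
  ultimately have "killed_resolvent S (A_gamma S) x = gain S x - value_fun S x"
    by (rule LIMSEQ_unique)
  then have "value_fun S x = gain S x - killed_resolvent S (A_gamma S) x" by simp
  then show ?thesis
    by (simp add: killed_resolvent_def discounted_integral_def upto_time_def)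
qed

end
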